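(* Let $f:\mathbb R_+\times\mathbb R_+\to\mathbb R_+$ be Borel measurable and $\delta>\rho\ge0$. Then $$\mathbf E_0\left(f(M_{\theta_\delta},\theta_\delta)\mid\mathcal F_{\theta_\rho}\right)=Q_{\rho,\delta}(M_{\theta_\rho},\theta_\rho;f),$$ where $$Q_{\rho,\delta}(y,s;f)=\mathbf E_{y-\rho}\left(f(y,s+H_{y-\delta});\,H_{y-\delta}<H_y\right)+\mathbf E_{y-\rho}\left(F_\delta(y,s+H_y);\,H_y<H_{y-\delta}\right)$$ and, for $a>0$, $F_\delta(y,a):=\mathbf E_y\left(f(M_{\theta_\delta},a+\theta_\delta)\right)$. In particular, for Borel measurable $f:\mathbb R_+\to\mathbb R_+$, $$\mathbf E_0\left(f(M_{\theta_\delta})\mid\mathcal F_{\theta_\rho}\right)=Q_{\rho,\delta}(M_{\theta_\rho};f),$$ where $$Q_{\rho,\delta}(y;f):=f(y)\,\mathbf P_{y-\rho}(H_{y-\delta}<H_y)+\mathbf E_y\left(f(M_{\theta_\delta})\right)\mathbf P_{y-\rho}(H_y<H_{y-\delta}),$$ and, hence, $(M_{\theta_\delta})_{\delta\ge0}$ is a Markov process with respect to its own filtration $(\sigma\{M_{\theta_u}:u\le\tau\})_{\tau\ge0}$.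
   Context: $X=(X_t)_{t\ge 0}$ is a regular one-dimensional diffusion in the sense of Itô and McKean (strong Markov, continuous paths) on an interval with left endpoint $l=-\infty$ and right endpoint $r=+\infty$, not killed inside it, started at $X_0=0$ under $\mathbf P_0$; $\mathbf P_x,\mathbf E_x$ denote probability and expectation when $X_0=x$, and $\mathbf E_x(Y;A)=\mathbf E_x(Y\mathbf 1_A)$. $\mathcal F_t$ is the $\sigma$-algebra generated by $X$ up to time $t$. The scale function $S$ is continuously differentiable and the speed measure has a continuous density with respect to Lebesgue measure. $X$ is either recurrent with $S(+\infty)=+\infty$, $S(-\infty)=-\infty$, or transient with $S(+\infty)<\infty$, $S(-\infty)=-\infty$. $M_t:=\max_{0\le s\le t}X_s$, $\theta_\delta:=\inf\{t\ge0:M_t-X_t>\delta\}$, $H_y:=\inf\{t\ge0:X_t=y\}$. It is assumed that $\theta_\delta$ is a.s. finite for all $\delta$. *)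

theory Defs
  imports "HOL-Probability.Probability"
begin

text \<open>
  A diffusion on the open interval \<open>(-\<infinity>, \<infinity>)\<close> is given by a measurable space \<open>M\<close>, laws \<open>P x\<close> on it and
  a process \<open>X\<close> with time set \<open>[0, \<infinity>)\<close>. Random times live in \<^typ>\<open>ennreal\<close>, with value
  \<open>\<infinity>\<close> (infimum of the empty set) if the event never occurs. Paths take values in \<^typ>\<open>ereal\<close>:
  no killing inside the interval still allows the path to leave it through an endpoint in
  finite time. The value \<open>\<infinity>\<close> serves as the cemetery, so \<open>X\<close> is alive at time \<open>t\<close> iff \<open>X t < \<infinity>\<close>.
\<close>

definition natural_filtration ::
  "'w measure \<Rightarrow> (real \<Rightarrow> 'w \<Rightarrow> 'b::topological_space) \<Rightarrow> ennreal \<Rightarrow> 'w measure" where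
  "natural_filtration M X t =
     sigma (space M) (\<Union>s\<in>{s. 0 \<le> s \<and> ennreal s \<le> t}. {X s -` B \<inter> space M |B. B \<in> sets borel})"

text \<open>
  \<open>F\<^sub>t\<^sub>+ = \<Inter>\<^sub>s\<^sub>>\<^sub>t F\<^sub>s\<close>; inserting \<open>\<top>\<close> only matters for \<open>t = \<top>\<close>. Stopping times of this filtration
  are the Markov times \<open>T\<close> of Ito and McKean (\<open>{T < t} \<in> F\<^sub>t\<close> for all \<open>t\<close>), such as the
  drawdown times below, which are in general not stopping times of the natural filtration.
\<close>

definition right_filtration ::
  "'w measure \<Rightarrow> (real \<Rightarrow> 'w \<Rightarrow> 'b::topological_space) \<Rightarrow> ennreal \<Rightarrow> 'w measure" where
  "right_filtration M X t =
     sigma (space M) (\<Inter>s\<in>insert \<top> {t<..}. sets (natural_filtration M X s))"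

lemma space_natural_filtration: "space (natural_filtration M X t) = space M"
  unfolding natural_filtration_def by (rule space_measure_of) auto

lemma right_filtration_subset:
  "(\<Inter>s\<in>insert \<top> {t<..}. sets (natural_filtration M X s)) \<subseteq> Pow (space M)"
  using sets.space_closed[of "natural_filtration M X \<top>"] by (auto simp: space_natural_filtration)

lemma sets_right_filtration:
  "sets (right_filtration M X t) = (\<Inter>s\<in>insert \<top> {t<..}. sets (natural_filtration M X s))"
proof
  show "sets (right_filtration M X t) \<subseteq> (\<Inter>s\<in>insert \<top> {t<..}. sets (natural_filtration M X s))"
  proof (rule INT_greatest)
    fix s assume s: "s \<in> insert \<top> {t<..}"
    have "sigma_sets (space (natural_filtration M X s))
            (\<Inter>s\<in>insert \<top> {t<..}. sets (natural_filtration M X s)) \<subseteq> sets (natural_filtration M X s)"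
      using s by (intro sets.sigma_sets_subset) blast
    then show "sets (right_filtration M X t) \<subseteq> sets (natural_filtration M X s)"
      using right_filtration_subset[of M X t]
      by (simp add: right_filtration_def space_natural_filtration sets_measure_of)
  qed
  show "(\<Inter>s\<in>insert \<top> {t<..}. sets (natural_filtration M X s)) \<subseteq> sets (right_filtration M X t)"
    unfolding right_filtration_def
    using right_filtration_subset[of M X t] by (auto simp: sets_measure_of)
qed

lemma filtration_right_filtration: "filtration (space M) (right_filtration M X)"
proof
  show "space (right_filtration M X t) = space M" for t
    unfolding right_filtration_def by (rule space_measure_of[OF right_filtration_subset])
  show "sets (right_filtration M X s) \<subseteq> sets (right_filtration M X t)" if "s \<le> t" for s t
    unfolding sets_right_filtration using that by (intro INF_superset_mono) auto
qed

definition stopped_sigma ::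
  "'w measure \<Rightarrow> (real \<Rightarrow> 'w \<Rightarrow> 'b::topological_space) \<Rightarrow> ('w \<Rightarrow> ennreal) \<Rightarrow> 'w measure" where
  "stopped_sigma M X T = filtration.pre_sigma (space M) (right_filtration M X) T"

definition hit :: "(real \<Rightarrow> 'w \<Rightarrow> ereal) \<Rightarrow> real \<Rightarrow> 'w \<Rightarrow> ennreal" where
  "hit X y \<omega> = Inf {ennreal t |t. 0 \<le> t \<and> X t \<omega> = ereal y}"

definition run_max :: "(real \<Rightarrow> 'w \<Rightarrow> ereal) \<Rightarrow> real \<Rightarrow> 'w \<Rightarrow> ereal" where
  "run_max X t \<omega> = (SUP s\<in>{0..t}. X s \<omega>)"

text \<open>The condition \<open>X t < \<infinity>\<close> restricts to times before explosion; note that \<open>\<infinity> - \<infinity> = \<infinity>\<close> in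
  \<^typ>\<open>ereal\<close>.\<close>

definition drawdown_time :: "(real \<Rightarrow> 'w \<Rightarrow> ereal) \<Rightarrow> real \<Rightarrow> 'w \<Rightarrow> ennreal" where
  "drawdown_time X \<delta> \<omega> =
     Inf {ennreal t |t. 0 \<le> t \<and> X t \<omega> < \<infinity> \<and> run_max X t \<omega> - X t \<omega> > ereal \<delta>}"

text \<open>The coercions are harmless where \<open>drawdown_time X \<delta> \<omega> < \<infinity>\<close>: the path is then alive up to
  and including that time, so the maximum is a real number.\<close>

definition drawdown_max :: "(real \<Rightarrow> 'w \<Rightarrow> ereal) \<Rightarrow> real \<Rightarrow> 'w \<Rightarrow> real" where
  "drawdown_max X \<delta> \<omega> = real_of_ereal (run_max X (enn2real (drawdown_time X \<delta> \<omega>)) \<omega>)"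

definition path_from :: "(real \<Rightarrow> 'w \<Rightarrow> ereal) \<Rightarrow> real \<Rightarrow> 'w \<Rightarrow> real \<Rightarrow> ereal" where
  "path_from X u \<omega> = (\<lambda>s\<in>{0..}. X (u + s) \<omega>)"

text \<open>
  The strong Markov property says that, given \<open>F\<^sub>T\<^sub>+\<close> and on the event that \<open>T\<close> is finite and \<open>X\<close> is
  alive at \<open>T\<close>, the path after \<open>T\<close> has the law of \<open>X\<close> started at \<open>X\<^sub>T\<close>. Exit through \<open>-\<infinity>\<close> is
  excluded; this is no restriction when \<open>S(-\<infinity>) = -\<infinity>\<close>, since then \<open>-\<infinity>\<close> is almost surely not reached.
\<close>

locale regular_diffusion =
  fixes M :: "'w measure" and P :: "real \<Rightarrow> 'w measure" and X :: "real \<Rightarrow> 'w \<Rightarrow> ereal"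
  assumes kernel: "P \<in> borel \<rightarrow>\<^sub>M prob_algebra M"
    and measurable_X: "0 \<le> t \<Longrightarrow> X t \<in> borel_measurable M"
    and continuous_X: "\<omega> \<in> space M \<Longrightarrow> continuous_on {0..} (\<lambda>t. X t \<omega>)"
    and not_minf: "\<omega> \<in> space M \<Longrightarrow> 0 \<le> t \<Longrightarrow> X t \<omega> \<noteq> -\<infinity>"
    and absorbed: "\<omega> \<in> space M \<Longrightarrow> 0 \<le> s \<Longrightarrow> s \<le> t \<Longrightarrow> X s \<omega> = \<infinity> \<Longrightarrow> X t \<omega> = \<infinity>"
    and start: "AE \<omega> in P x. X 0 \<omega> = ereal x"
    and strong_Markov:
      "stopping_time (right_filtration M X) T \<Longrightarrow> A \<in> sets (stopped_sigma M X T) \<Longrightarrow>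
       B \<in> sets (PiM {0..} (\<lambda>_. borel)) \<Longrightarrow>
       alive = {\<omega>\<in>space M. T \<omega> < \<infinity> \<and> X (enn2real (T \<omega>)) \<omega> < \<infinity>} \<Longrightarrow>
       emeasure (P x) {\<omega>\<in>A \<inter> alive. path_from X (enn2real (T \<omega>)) \<omega> \<in> B} =
       (\<integral>\<^sup>+\<omega>\<in>A \<inter> alive.
          emeasure (P (real_of_ereal (X (enn2real (T \<omega>)) \<omega>))) {\<omega>'\<in>space M. path_from X 0 \<omega>' \<in> B} \<partial>P x)"
    and regular: "emeasure (P x) {\<omega>\<in>space M. hit X y \<omega> < \<infinity>} > 0"

definition scale_function ::
  "(real \<Rightarrow> 'w measure) \<Rightarrow> (real \<Rightarrow> 'w \<Rightarrow> ereal) \<Rightarrow> (real \<Rightarrow> real) \<Rightarrow> bool" where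
  "scale_function P X S \<longleftrightarrow> strict_mono S \<and> continuous_on UNIV S \<and>
     (\<forall>a x b. a < x \<and> x < b \<longrightarrow>
        measure (P x) {\<omega>\<in>space (P x). hit X a \<omega> < hit X b \<omega>} = (S b - S x) / (S b - S a))"

text \<open>
  Speed measure with respect to the scale \<open>S\<close>, normalised so that the generator is \<open>d/dm d/dS\<close>
  (for Brownian motion and \<open>S x = x\<close> it is twice Lebesgue measure). In the absence of killing it
  is determined by the mean exit times from bounded intervals through the Green function.
\<close>

definition speed_measure ::
  "(real \<Rightarrow> 'w measure) \<Rightarrow> (real \<Rightarrow> 'w \<Rightarrow> ereal) \<Rightarrow> (real \<Rightarrow> real) \<Rightarrow> real measure \<Rightarrow> bool" where
  "speed_measure P X S m \<longleftrightarrow> sets m = sets borel \<and>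
     (\<forall>a x b. a < x \<and> x < b \<longrightarrow>
        (\<integral>\<^sup>+\<omega>. min (hit X a \<omega>) (hit X b \<omega>) \<partial>P x) =
        (\<integral>\<^sup>+y\<in>{a<..<b}. ennreal ((S (min x y) - S a) * (S b - S (max x y)) / (S b - S a)) \<partial>m))"

definition recurrent :: "(real \<Rightarrow> 'w measure) \<Rightarrow> (real \<Rightarrow> 'w \<Rightarrow> ereal) \<Rightarrow> bool" where
  "recurrent P X \<longleftrightarrow> (\<forall>x y. AE \<omega> in P x. hit X y \<omega> < \<infinity>)"

abbreviation transient :: "(real \<Rightarrow> 'w measure) \<Rightarrow> (real \<Rightarrow> 'w \<Rightarrow> ereal) \<Rightarrow> bool" where
  "transient P X \<equiv> \<not> recurrent P X"

definition F_dd :: "(real \<Rightarrow> 'w measure) \<Rightarrow> (real \<Rightarrow> 'w \<Rightarrow> ereal) \<Rightarrow> (real \<times> real \<Rightarrow> real) \<Rightarrow>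
    real \<Rightarrow> real \<Rightarrow> real \<Rightarrow> ennreal" where
  "F_dd P X f \<delta> y a =
     (\<integral>\<^sup>+\<omega>. ennreal (f (drawdown_max X \<delta> \<omega>, a + enn2real (drawdown_time X \<delta> \<omega>))) \<partial>P y)"

definition Q_dd :: "(real \<Rightarrow> 'w measure) \<Rightarrow> (real \<Rightarrow> 'w \<Rightarrow> ereal) \<Rightarrow> (real \<times> real \<Rightarrow> real) \<Rightarrow>
    real \<Rightarrow> real \<Rightarrow> real \<Rightarrow> real \<Rightarrow> ennreal" where
  "Q_dd P X f \<rho> \<delta> y s =
     (\<integral>\<^sup>+\<omega>\<in>{\<omega>. hit X (y - \<delta>) \<omega> < hit X y \<omega>}.
        ennreal (f (y, s + enn2real (hit X (y - \<delta>) \<omega>))) \<partial>P (y - \<rho>)) +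
     (\<integral>\<^sup>+\<omega>\<in>{\<omega>. hit X y \<omega> < hit X (y - \<delta>) \<omega>}.
        F_dd P X f \<delta> y (s + enn2real (hit X y \<omega>)) \<partial>P (y - \<rho>))"

definition Q_dd_max :: "(real \<Rightarrow> 'w measure) \<Rightarrow> (real \<Rightarrow> 'w \<Rightarrow> ereal) \<Rightarrow> (real \<Rightarrow> real) \<Rightarrow>
    real \<Rightarrow> real \<Rightarrow> real \<Rightarrow> ennreal" where
  "Q_dd_max P X f \<rho> \<delta> y =
     ennreal (f y) *
       emeasure (P (y - \<rho>)) {\<omega>\<in>space (P (y - \<rho>)). hit X (y - \<delta>) \<omega> < hit X y \<omega>} +
     (\<integral>\<^sup>+\<omega>. ennreal (f (drawdown_max X \<delta> \<omega>)) \<partial>P y) *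
       emeasure (P (y - \<rho>)) {\<omega>\<in>space (P (y - \<rho>)). hit X y \<omega> < hit X (y - \<delta>) \<omega>}"

definition Markov_process :: "'w measure \<Rightarrow> (real \<Rightarrow> 'w \<Rightarrow> real) \<Rightarrow> bool" where
  "Markov_process N Y \<longleftrightarrow>
     (\<forall>t\<ge>0. Y t \<in> borel_measurable N) \<and>
     (\<forall>s t B. 0 \<le> s \<and> s \<le> t \<and> B \<in> sets borel \<longrightarrow>
        (AE \<omega> in N.
           real_cond_exp N (natural_filtration N Y (ennreal s)) (\<lambda>\<omega>. indicator B (Y t \<omega>)) \<omega> =
           real_cond_exp N (vimage_algebra (space N) (Y s) borel) (\<lambda>\<omega>. indicator B (Y t \<omega>)) \<omega>))"

end

theory Submission
  imports Defs
begin

text \<open>Let \<open>y\<close> be the maximum reached at the drawdown time \<open>\<theta>\<^sub>\<rho>\<close>, so that the path sits at level \<open>y - \<rho>\<close> at that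
time. As long as the path after \<open>\<theta>\<^sub>\<rho>\<close> stays between \<open>y - \<delta>\<close> and \<open>y\<close>, the maximum remains \<open>y\<close> and no drawdown
larger than \<open>\<delta>\<close> occurs (\<open>corridor_after_drawdown\<close>). Suppose that it reaches \<open>y\<close> first. There it is at its
running maximum, and what happened before can no longer influence the drawdown: \<open>\<theta>\<^sub>\<delta>\<close> is the time of
this visit plus the drawdown time of the path that starts there, and the maxima agree
(\<open>drawdown_if_upper_first\<close>). Suppose that it reaches \<open>y - \<delta>\<close> first. There the drawdown equals \<open>\<delta>\<close>, and
since a diffusion goes below a level immediately after hitting it, \<open>\<theta>\<^sub>\<delta>\<close> is this very moment and the
maximum is still \<open>y\<close> (\<open>drawdown_if_lower_first\<close>). One of the two happens whenever \<open>\<theta>\<^sub>\<delta>\<close> is finite.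

Hence \<open>(M\<^bsub>\<theta>\<^sub>\<delta>\<^esub>, \<theta>\<^sub>\<delta>)\<close> is a measurable function of \<open>(M\<^bsub>\<theta>\<^sub>\<rho>\<^esub>, \<theta>\<^sub>\<rho>)\<close> and of the path after \<open>\<theta>\<^sub>\<rho>\<close>. The pair is known at
time \<open>\<theta>\<^sub>\<rho>\<close>, and the path after \<open>\<theta>\<^sub>\<rho>\<close> has the law of the diffusion started at \<open>y - \<rho>\<close>; so the conditional
expectation is obtained by integrating over that law with the pair fixed (\<open>strong_Markov_integral\<close>). A second
application of the strong Markov property, at the hitting time of \<open>y\<close>, turns the restarted part into
\<open>F\<^sub>\<delta>\<close>, and the result is \<open>Q\<close> (\<open>Q_dd_eq_law\<close>).

That a level \<open>z\<close> is crossed immediately follows from scale and speed (\<open>AE_law_crosses_down\<close>). By the exit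
probabilities, the path from \<open>z\<close> visits some level below \<open>z\<close> before it reaches a given level above \<open>z\<close>; by
the mean exit times, it leaves the intervals that shrink to \<open>z\<close> in times that decrease to \<open>0\<close>.

For the Markov property of \<open>\<delta> \<mapsto> M\<^bsub>\<theta>\<^sub>\<delta>\<^esub>\<close>, the kernel \<open>Q\<close> for functions of the maximum alone depends only on
\<open>M\<^bsub>\<theta>\<^sub>s\<^esub>\<close>, while the maxima \<open>M\<^bsub>\<theta>\<^sub>u\<^esub>\<close> with \<open>u \<le> s\<close> are known at time \<open>\<theta>\<^sub>s\<close>. Every \<open>\<sigma>\<close>-algebra
of events known at time \<open>\<theta>\<^sub>s\<close> for which \<open>M\<^bsub>\<theta>\<^sub>s\<^esub>\<close> is measurable therefore gives the same conditional
probabilities.\<close>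

section \<open>Paths, running maxima and hitting times\<close>

lemma rational_near:
  fixes s :: real
  assumes "0 < e"
  obtains q where "q \<in> \<rat>" "s < q" "q < s + e"
  using Rats_dense_in_real[of s "s + e"] assms by auto

text \<open>The part of the assumptions on a diffusion that concerns single paths and measurability. It is
separated because it also holds for the coordinate process on the space of paths and for the process
on the \<open>\<sigma>\<close>-algebra that it generates, where the same measurability results are needed.\<close>
locale path_process =
  fixes M :: "'w measure" and X :: "real \<Rightarrow> 'w \<Rightarrow> ereal"
  assumes measurable_X: "0 \<le> t \<Longrightarrow> X t \<in> borel_measurable M"
    and continuous_X: "\<omega> \<in> space M \<Longrightarrow> continuous_on {0..} (\<lambda>t. X t \<omega>)"
    and not_minf: "\<omega> \<in> space M \<Longrightarrow> 0 \<le> t \<Longrightarrow> X t \<omega> \<noteq> -\<infinity>"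
    and absorbed: "\<omega> \<in> space M \<Longrightarrow> 0 \<le> s \<Longrightarrow> s \<le> t \<Longrightarrow> X s \<omega> = \<infinity> \<Longrightarrow> X t \<omega> = \<infinity>"
begin

lemma X_near_open:
  assumes "\<omega> \<in> space M" "0 \<le> s" "open U" "X s \<omega> \<in> U"
  obtains e where "e > 0" "\<And>r. 0 \<le> r \<Longrightarrow> \<bar>r - s\<bar> < e \<Longrightarrow> X r \<omega> \<in> U"
proof -
  have "((\<lambda>t. X t \<omega>) \<longlongrightarrow> X s \<omega>) (at s within {0..})"
    using continuous_X[OF assms(1)] assms(2) by (auto simp: continuous_on_def)
  then have "eventually (\<lambda>r. X r \<omega> \<in> U) (at s within {0..})"
    using assms(3,4) by (rule topological_tendstoD)
  then obtain e where e: "e > 0" "\<And>r. r \<in> {0..} \<Longrightarrow> r \<noteq> s \<Longrightarrow> dist r s < e \<Longrightarrow> X r \<omega> \<in> U"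
    unfolding eventually_at by blast
  show thesis
    by (rule that[OF e(1)]) (use e(2) assms(4) in \<open>force simp: dist_real_def\<close>)
qed

lemma run_max_attained:
  assumes "\<omega> \<in> space M" "0 \<le> t"
  obtains s where "0 \<le> s" "s \<le> t" "X s \<omega> = run_max X t \<omega>"
proof -
  have "\<exists>s\<in>{0..t}. \<forall>r\<in>{0..t}. X r \<omega> \<le> X s \<omega>"
    using assms continuous_on_subset[OF continuous_X[OF assms(1)]]
    by (intro continuous_attains_sup) auto
  then obtain s where s: "s \<in> {0..t}" "\<And>r. r \<in> {0..t} \<Longrightarrow> X r \<omega> \<le> X s \<omega>" by blast
  then have "run_max X t \<omega> = X s \<omega>"
    unfolding run_max_def by (intro antisym SUP_least SUP_upper)
  then show thesis using that s(1) by auto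
qed

definition run_min :: "real \<Rightarrow> 'w \<Rightarrow> ereal" where
  "run_min t \<omega> = (INF s\<in>{0..t}. X s \<omega>)"

lemma run_min_attained:
  assumes "\<omega> \<in> space M" "0 \<le> t"
  obtains s where "0 \<le> s" "s \<le> t" "X s \<omega> = run_min t \<omega>"
proof -
  have "\<exists>s\<in>{0..t}. \<forall>r\<in>{0..t}. X s \<omega> \<le> X r \<omega>"
    using assms continuous_on_subset[OF continuous_X[OF assms(1)]]
    by (intro continuous_attains_inf) auto
  then obtain s where s: "s \<in> {0..t}" "\<And>r. r \<in> {0..t} \<Longrightarrow> X s \<omega> \<le> X r \<omega>" by blast
  then have "run_min t \<omega> = X s \<omega>"
    unfolding run_min_def by (intro antisym INF_greatest INF_lower)
  then show thesis using that s(1) by auto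
qed

lemma run_max_ge: "0 \<le> s \<Longrightarrow> s \<le> t \<Longrightarrow> X s \<omega> \<le> run_max X t \<omega>"
  unfolding run_max_def by (intro SUP_upper) auto

lemma rational_fraction_near:
  assumes "\<omega> \<in> space M" "0 \<le> s" "s \<le> t" "open U" "X s \<omega> \<in> U"
  obtains q where "q \<in> \<rat> \<inter> {0..1}" "X (t * q) \<omega> \<in> U"
proof (cases "t = 0")
  case True
  then show thesis using that[of 0] assms by auto
next
  case False
  with assms have t: "t > 0" by auto
  obtain e where e: "e > 0" "\<And>r. 0 \<le> r \<Longrightarrow> \<bar>r - s\<bar> < e \<Longrightarrow> X r \<omega> \<in> U"
    using X_near_open[OF assms(1,2,4,5)] by blast
  have "max 0 (s - e) / t < min t (s + e) / t"
    using t e(1) assms(2,3) by (intro divide_strict_right_mono) auto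
  then obtain q where q: "q \<in> \<rat>" "max 0 (s - e) / t < q" "q < min t (s + e) / t"
    using Rats_dense_in_real by blast
  then have *: "max 0 (s - e) < t * q" "t * q < min t (s + e)"
    using t by (auto simp: field_simps)
  then have "0 < t * q" "t * q < t * 1" by auto
  then have "0 < q" "q < 1" using t by (auto simp: zero_less_mult_iff)
  then show thesis using * q(1) e(2)[of "t * q"] t by (intro that[of q]) auto
qed

text \<open>Rational fractions of \<open>t\<close> are used instead of rational times so that the index set does not depend
on \<open>t\<close>: the formula then gives measurability for fixed \<open>t\<close> and jointly in \<open>t\<close> and the path.\<close>
lemma run_max_rat:
  assumes "\<omega> \<in> space M" "0 \<le> t"
  shows "run_max X t \<omega> = (SUP q\<in>\<rat> \<inter> {0..1}. X (t * q) \<omega>)"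
proof (rule antisym)
  show "(SUP q\<in>\<rat> \<inter> {0..1}. X (t * q) \<omega>) \<le> run_max X t \<omega>"
    using assms(2) by (intro SUP_least run_max_ge) (auto simp: mult_left_le)
  show "run_max X t \<omega> \<le> (SUP q\<in>\<rat> \<inter> {0..1}. X (t * q) \<omega>)"
  proof (rule ccontr)
    obtain s where s: "0 \<le> s" "s \<le> t" "X s \<omega> = run_max X t \<omega>"
      using run_max_attained[OF assms] .
    assume "\<not> ?thesis"
    then have "X s \<omega> \<in> {SUP q\<in>\<rat> \<inter> {0..1}. X (t * q) \<omega><..}"
      using s(3) by (simp add: not_le)
    from rational_fraction_near[OF assms(1) s(1,2) _ this] obtain q where q: "q \<in> \<rat> \<inter> {0..1}" "(SUP q\<in>\<rat> \<inter> {0..1}. X (t * q) \<omega>) < X (t * q) \<omega>"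
      by auto
    moreover have "X (t * q) \<omega> \<le> (SUP q\<in>\<rat> \<inter> {0..1}. X (t * q) \<omega>)"
      using q(1) by (rule SUP_upper)
    ultimately show False by auto
  qed
qed

lemma run_min_rat:
  assumes "\<omega> \<in> space M" "0 \<le> t"
  shows "run_min t \<omega> = (INF q\<in>\<rat> \<inter> {0..1}. X (t * q) \<omega>)"
proof (rule antisym)
  show "run_min t \<omega> \<le> (INF q\<in>\<rat> \<inter> {0..1}. X (t * q) \<omega>)"
    unfolding run_min_def using assms(2) by (intro INF_greatest INF_lower) (auto simp: mult_left_le)
  show "(INF q\<in>\<rat> \<inter> {0..1}. X (t * q) \<omega>) \<le> run_min t \<omega>"
  proof (rule ccontr)
    obtain s where s: "0 \<le> s" "s \<le> t" "X s \<omega> = run_min t \<omega>"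
      using run_min_attained[OF assms] .
    assume "\<not> ?thesis"
    then have "X s \<omega> \<in> {..<INF q\<in>\<rat> \<inter> {0..1}. X (t * q) \<omega>}"
      using s(3) by (simp add: not_le)
    from rational_fraction_near[OF assms(1) s(1,2) _ this] obtain q where q: "q \<in> \<rat> \<inter> {0..1}" "X (t * q) \<omega> < (INF q\<in>\<rat> \<inter> {0..1}. X (t * q) \<omega>)"
      by auto
    moreover have "(INF q\<in>\<rat> \<inter> {0..1}. X (t * q) \<omega>) \<le> X (t * q) \<omega>"
      using q(1) by (rule INF_lower)
    ultimately show False by auto
  qed
qed

lemma measurable_run_max_min:
  assumes "space G = space M" "\<And>s. 0 \<le> s \<Longrightarrow> s \<le> t \<Longrightarrow> X s \<in> borel_measurable G" "0 \<le> t"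
  shows "run_max X t \<in> borel_measurable G" "run_min t \<in> borel_measurable G"
proof -
  have m: "(\<lambda>\<omega>. X (t * q) \<omega>) \<in> borel_measurable G" if "q \<in> \<rat> \<inter> {0..1}" for q
    using that assms(3) by (intro assms(2)) (auto simp: mult_left_le)
  have "(\<lambda>\<omega>. SUP q\<in>\<rat> \<inter> {0..1}. X (t * q) \<omega>) \<in> borel_measurable G"
    using m by (intro borel_measurable_SUP countable_Int1 countable_rat)
  then show "run_max X t \<in> borel_measurable G"
    using assms(1,3) by (subst measurable_cong[OF run_max_rat]) auto
  have "(\<lambda>\<omega>. INF q\<in>\<rat> \<inter> {0..1}. X (t * q) \<omega>) \<in> borel_measurable G"
    using m by (intro borel_measurable_INF countable_Int1 countable_rat)
  then show "run_min t \<in> borel_measurable G"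
    using assms(1,3) by (subst measurable_cong[OF run_min_rat]) auto
qed

text \<open>Continuity makes the process the limit of its values at the times \<open>\<lceil>n t\<rceil> / n\<close>, and each of these
approximations takes countably many times. The maximum with \<open>0\<close> only extends the process to
negative times.\<close>
lemma joint_measurable_X: "(\<lambda>(t, \<omega>). X (max 0 t) \<omega>) \<in> borel_measurable (borel \<Otimes>\<^sub>M M)"
proof -
  let ?r = "\<lambda>n t. nat \<lceil>max 0 t * real (Suc n)\<rceil>"
  have *: "(\<lambda>p. X (real (?r n (fst p)) / real (Suc n)) (snd p)) \<in> borel_measurable (borel \<Otimes>\<^sub>M M)" for n
    by (rule measurable_compose_countable[where g="\<lambda>p. ?r n (fst p)" and f="\<lambda>k p. X (real k / real (Suc n)) (snd p)"])
       (auto intro: measurable_compose[OF measurable_snd measurable_X])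
  have "(\<lambda>p. X (max 0 (fst p)) (snd p)) \<in> borel_measurable (borel \<Otimes>\<^sub>M M)"
  proof (rule borel_measurable_LIMSEQ_order[OF _ *])
    fix p :: "real \<times> 'w" assume "p \<in> space (borel \<Otimes>\<^sub>M M)"
    then have p: "snd p \<in> space M" by (auto simp: space_pair_measure)
    let ?t = "max 0 (fst p)"
    have "(\<lambda>n. real (?r n (fst p)) / real (Suc n)) \<longlonglongrightarrow> ?t"
    proof (rule tendsto_sandwich[where f="\<lambda>n. ?t" and h="\<lambda>n. ?t + 1 / real (Suc n)"])
      have le: "?t * real (Suc n) \<le> real (?r n (fst p))" "real (?r n (fst p)) \<le> ?t * real (Suc n) + 1" for n
        by (auto simp: of_nat_nat intro!: real_nat_ceiling_ge)
      show "\<forall>\<^sub>F n in sequentially. ?t \<le> real (?r n (fst p)) / real (Suc n)"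
        using le(1) by (intro always_eventually allI) (simp only: le_divide_eq, simp)
      show "\<forall>\<^sub>F n in sequentially. real (?r n (fst p)) / real (Suc n) \<le> ?t + 1 / real (Suc n)"
      proof (intro always_eventually allI)
        fix n
        have "real (?r n (fst p)) / real (Suc n) \<le> (?t * real (Suc n) + 1) / real (Suc n)"
          by (rule divide_right_mono[OF le(2)]) auto
        also have "\<dots> = ?t + 1 / real (Suc n)" by (simp add: add_divide_distrib)
        finally show "real (?r n (fst p)) / real (Suc n) \<le> ?t + 1 / real (Suc n)" .
      qed
      show "(\<lambda>n. ?t + 1 / real (Suc n)) \<longlonglongrightarrow> ?t"
        using tendsto_add[OF tendsto_const[of ?t] lim_inverse_n'[THEN LIMSEQ_Suc]] by simp
    qed simp
    then show "(\<lambda>n. X (real (?r n (fst p)) / real (Suc n)) (snd p)) \<longlonglongrightarrow> X ?t (snd p)"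
      by (rule continuous_on_tendsto_compose[OF continuous_X[OF p]])
        (simp, intro always_eventually allI, simp only: atLeast_iff divide_nonneg_nonneg of_nat_0_le_iff)
  qed
  then show ?thesis by (simp add: split_beta')
qed

lemma joint_measurable_run_max:
  "(\<lambda>(t, \<omega>). run_max X (max 0 t) \<omega>) \<in> borel_measurable (borel \<Otimes>\<^sub>M M)"
proof -
  have "(\<lambda>p. SUP q\<in>\<rat> \<inter> {0..1}. X (max 0 (fst p) * q) (snd p)) \<in> borel_measurable (borel \<Otimes>\<^sub>M M)"
  proof (intro borel_measurable_SUP countable_Int1 countable_rat)
    fix q :: real assume "q \<in> \<rat> \<inter> {0..1}"
    then have "max 0 (fst p) * q = max 0 (fst p * q)" for p :: "real \<times> 'w"
      by (auto simp: max_def mult_le_0_iff zero_le_mult_iff)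
    then show "(\<lambda>p. X (max 0 (fst p) * q) (snd p)) \<in> borel_measurable (borel \<Otimes>\<^sub>M M)"
      using measurable_compose[OF _ joint_measurable_X, of "\<lambda>p. (fst p * q, snd p)" "borel \<Otimes>\<^sub>M M"]
      by simp
  qed
  then show ?thesis
    by (subst measurable_cong[where g="\<lambda>p. SUP q\<in>\<rat> \<inter> {0..1}. X (max 0 (fst p) * q) (snd p)"])
       (auto simp: space_pair_measure run_max_rat)
qed

text \<open>The infimum in the definition of the hitting time is attained because the path is continuous.\<close>
lemma hit_le_iff:
  assumes "\<omega> \<in> space M" "0 \<le> t"
  shows "hit X y \<omega> \<le> ennreal t \<longleftrightarrow> (\<exists>s\<in>{0..t}. X s \<omega> = ereal y)"
proof
  assume "\<exists>s\<in>{0..t}. X s \<omega> = ereal y"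
  then obtain s where "0 \<le> s" "s \<le> t" "X s \<omega> = ereal y" by auto
  then have "hit X y \<omega> \<le> ennreal s" unfolding hit_def by (intro Inf_lower) auto
  also have "\<dots> \<le> ennreal t" using \<open>s \<le> t\<close> by (rule ennreal_leI)
  finally show "hit X y \<omega> \<le> ennreal t" .
next
  assume le: "hit X y \<omega> \<le> ennreal t"
  show "\<exists>s\<in>{0..t}. X s \<omega> = ereal y"
  proof (rule ccontr)
    assume n: "\<not> ?thesis"
    then have "X t \<omega> \<in> - {ereal y}" using assms(2) by auto
    then obtain e where e: "e > 0" "\<And>r. 0 \<le> r \<Longrightarrow> \<bar>r - t\<bar> < e \<Longrightarrow> X r \<omega> \<in> - {ereal y}"
      using X_near_open[OF assms, of "- {ereal y}"] by auto
    have "ennreal (t + e) \<le> hit X y \<omega>" unfolding hit_def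
    proof (intro Inf_greatest, safe)
      fix s assume s: "0 \<le> s" "X s \<omega> = ereal y"
      then have "t < s" using n by force
      have "\<not> s - t < e" using e(2)[of s] s \<open>t < s\<close> by auto
      then have "t + e \<le> s" by simp
      then show "ennreal (t + e) \<le> ennreal s" by (rule ennreal_leI)
    qed
    with le have "ennreal (t + e) \<le> ennreal t" by simp
    then show False using e(1) assms(2) by (simp add: ennreal_le_iff)
  qed
qed

lemma X_hit:
  assumes "\<omega> \<in> space M" "hit X y \<omega> < \<infinity>"
  shows "X (enn2real (hit X y \<omega>)) \<omega> = ereal y"
proof -
  let ?t = "enn2real (hit X y \<omega>)"
  have t: "ennreal ?t = hit X y \<omega>" using assms(2) by (simp add: less_top)
  then obtain s where s: "0 \<le> s" "s \<le> ?t" "X s \<omega> = ereal y"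
    using hit_le_iff[OF assms(1), of ?t y] by auto
  then have "hit X y \<omega> \<le> ennreal s" unfolding hit_def by (intro Inf_lower) auto
  then have "?t \<le> s" using s(1) by (subst (asm) t[symmetric]) (simp add: ennreal_le_iff)
  with s show ?thesis by simp
qed

lemma hit_le: "0 \<le> t \<Longrightarrow> X t \<omega> = ereal y \<Longrightarrow> hit X y \<omega> \<le> ennreal t"
  unfolding hit_def by (intro Inf_lower) auto

lemma X_IVT:
  assumes "\<omega> \<in> space M" "0 \<le> a" "a \<le> b"
    and "X a \<omega> \<le> c \<and> c \<le> X b \<omega> \<or> X b \<omega> \<le> c \<and> c \<le> X a \<omega>"
  obtains s where "a \<le> s" "s \<le> b" "X s \<omega> = c"
proof -
  have c: "continuous_on {a..b} (\<lambda>t. X t \<omega>)"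
    using assms by (intro continuous_on_subset[OF continuous_X]) auto
  show thesis
    using assms(3,4) IVT'[OF _ _ _ c, of c] IVT2'[OF _ _ _ c, of c] that by blast
qed

text \<open>By the intermediate value theorem a level has been hit as soon as it lies between the running minimum
and the running maximum. In this form the event is measurable jointly in the level and the path,
which is needed since the levels \<open>y\<close> and \<open>y - \<delta>\<close> of the proof are random.\<close>
lemma hit_le_iff_run:
  assumes "\<omega> \<in> space M" "0 \<le> t"
  shows "hit X y \<omega> \<le> ennreal t \<longleftrightarrow> run_min t \<omega> \<le> ereal y \<and> ereal y \<le> run_max X t \<omega>"
  unfolding hit_le_iff[OF assms]
proof
  assume "\<exists>s\<in>{0..t}. X s \<omega> = ereal y"
  then show "run_min t \<omega> \<le> ereal y \<and> ereal y \<le> run_max X t \<omega>"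
    unfolding run_min_def by (metis INF_lower atLeastAtMost_iff run_max_ge)
next
  assume *: "run_min t \<omega> \<le> ereal y \<and> ereal y \<le> run_max X t \<omega>"
  obtain a where a: "0 \<le> a" "a \<le> t" "X a \<omega> = run_min t \<omega>" using run_min_attained[OF assms] .
  obtain b where b: "0 \<le> b" "b \<le> t" "X b \<omega> = run_max X t \<omega>" using run_max_attained[OF assms] .
  show "\<exists>s\<in>{0..t}. X s \<omega> = ereal y"
  proof (cases "a \<le> b")
    case True
    then obtain s where "a \<le> s" "s \<le> b" "X s \<omega> = ereal y"
      using X_IVT[OF assms(1) a(1), of b "ereal y"] * a b by metis
    then show ?thesis using a b by auto
  next
    case False
    then obtain s where "b \<le> s" "s \<le> a" "X s \<omega> = ereal y"
      using X_IVT[OF assms(1) b(1), of a "ereal y"] * a b by (metis linear)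
    then show ?thesis using a b by auto
  qed
qed

lemma joint_measurable_hit: "(\<lambda>(y, \<omega>). hit X y \<omega>) \<in> borel_measurable (borel \<Otimes>\<^sub>M M)"
proof (rule borel_measurableI_le)
  fix a :: ennreal
  show "{p \<in> space (borel \<Otimes>\<^sub>M M). (case p of (y, \<omega>) \<Rightarrow> hit X y \<omega>) \<le> a} \<in> sets (borel \<Otimes>\<^sub>M M)"
  proof (cases a)
    case (real t)
    have [measurable]: "run_max X t \<in> borel_measurable M" "run_min t \<in> borel_measurable M"
      using real measurable_X by (auto intro!: measurable_run_max_min)
    have "{p \<in> space (borel \<Otimes>\<^sub>M M). (case p of (y, \<omega>) \<Rightarrow> hit X y \<omega>) \<le> a} =
      {p \<in> space (borel \<Otimes>\<^sub>M M). run_min t (snd p) \<le> ereal (fst p) \<and> ereal (fst p) \<le> run_max X t (snd p)}"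
      using real by (auto simp: space_pair_measure hit_le_iff_run)
    also have "\<dots> \<in> sets (borel \<Otimes>\<^sub>M M)" by measurable
    finally show ?thesis .
  qed simp
qed

lemma measurable_hit: "hit X y \<in> borel_measurable M"
  using measurable_compose[OF measurable_Pair1' joint_measurable_hit, of y] by simp

text \<open>Moving \<open>X t\<close> to the other side absorbs the condition of being alive: the right-hand side fails when
\<open>X t = \<infinity>\<close>.\<close>
lemma X_add_less_iff:
  assumes "\<omega> \<in> space M" "0 \<le> t"
  shows "X t \<omega> < \<infinity> \<and> run_max X t \<omega> - X t \<omega> > ereal \<delta> \<longleftrightarrow> (\<exists>s\<in>{0..t}. X t \<omega> + ereal \<delta> < X s \<omega>)"
proof (cases "X t \<omega>")
  case (real x)
  have "run_max X t \<omega> - ereal x > ereal \<delta> \<longleftrightarrow> ereal x + ereal \<delta> < run_max X t \<omega>"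
    by (cases "run_max X t \<omega>") (auto simp: algebra_simps)
  then show ?thesis using real by (simp add: run_max_def less_SUP_iff)
next
  case MInf then show ?thesis using not_minf[OF assms] by simp
qed auto

lemma drawdown_time_eq:
  assumes "\<omega> \<in> space M"
  shows "drawdown_time X \<delta> \<omega> = Inf {ennreal t |t. 0 \<le> t \<and> (\<exists>s\<in>{0..t}. X t \<omega> + ereal \<delta> < X s \<omega>)}"
  unfolding drawdown_time_def
  by (intro arg_cong[where f=Inf] Collect_cong ex_cong1 conj_cong refl X_add_less_iff[OF assms])

lemma drawdown_time_less_iff:
  assumes "\<omega> \<in> space M"
  shows "drawdown_time X \<delta> \<omega> < a \<longleftrightarrow> (\<exists>t s. 0 \<le> s \<and> s \<le> t \<and> ennreal t < a \<and> X t \<omega> + ereal \<delta> < X s \<omega>)"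
  unfolding drawdown_time_eq[OF assms] Inf_less_iff by fastforce

text \<open>The drawdown condition is open in both times, and by right-continuity both can be moved slightly to
the right to rational times.\<close>
lemma drawdown_time_less_iff_rat:
  assumes "\<omega> \<in> space M"
  shows "drawdown_time X \<delta> \<omega> < a \<longleftrightarrow>
    (\<exists>t\<in>\<rat> \<inter> {t. 0 \<le> t \<and> ennreal t < a}. \<exists>s\<in>\<rat> \<inter> {0..t}. X t \<omega> + ereal \<delta> < X s \<omega>)"
proof
  assume "\<exists>t\<in>\<rat> \<inter> {t. 0 \<le> t \<and> ennreal t < a}. \<exists>s\<in>\<rat> \<inter> {0..t}. X t \<omega> + ereal \<delta> < X s \<omega>"
  then show "drawdown_time X \<delta> \<omega> < a" unfolding drawdown_time_less_iff[OF assms] by (metis IntD2 atLeastAtMost_iff mem_Collect_eq)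
next
  assume "drawdown_time X \<delta> \<omega> < a"
  then obtain t s where ts: "0 \<le> s" "s \<le> t" "ennreal t < a" "X t \<omega> + ereal \<delta> < X s \<omega>"
    unfolding drawdown_time_less_iff[OF assms] by auto
  then obtain x where x: "X t \<omega> = ereal x" using not_minf[OF assms, of t] by (cases "X t \<omega>") auto
  obtain c where c: "ereal (x + \<delta>) < ereal c" "ereal c < X s \<omega>"
    using ereal_dense2[of "ereal (x + \<delta>)" "X s \<omega>"] ts(4) x by auto
  obtain e where e: "e > 0" "\<And>r. 0 \<le> r \<Longrightarrow> \<bar>r - t\<bar> < e \<Longrightarrow> X r \<omega> < ereal (c - \<delta>)"
    using X_near_open[OF assms, of t "{..<ereal (c - \<delta>)}"] ts x c(1) by auto
  obtain e' where e': "e' > 0" "\<And>r. 0 \<le> r \<Longrightarrow> \<bar>r - s\<bar> < e' \<Longrightarrow> ereal c < X r \<omega>"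
    using X_near_open[OF assms, of s "{ereal c<..}"] ts c(2) by auto
  obtain b :: rat where b: "ennreal t < ennreal (real_of_rat b)" "ennreal (real_of_rat b) < a"
    using ennreal_rat_dense[OF ts(3)] by auto
  then have bt: "t < real_of_rat b" using ts by (simp add: ennreal_less_iff)
  obtain q where q: "q \<in> \<rat>" "t < q" "q < t + min e (real_of_rat b - t)"
    using rational_near[of "min e (real_of_rat b - t)" t] e(1) bt by auto
  obtain r where r: "r \<in> \<rat>" "s < r" "r < s + min e' (q - t)"
    using rational_near[of "min e' (q - t)" s] e'(1) q by auto
  have "ennreal q \<le> ennreal (real_of_rat b)" using q by (intro ennreal_leI) auto
  then have "ennreal q < a" using b(2) by (rule le_less_trans)
  moreover have "X q \<omega> + ereal \<delta> < X r \<omega>"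
  proof -
    have "X q \<omega> < ereal (c - \<delta>)" using q ts by (intro e(2)) auto
    then have "X q \<omega> + ereal \<delta> < ereal c" by (cases "X q \<omega>") auto
    also have "ereal c < X r \<omega>" using r ts by (intro e'(2)) auto
    finally show ?thesis .
  qed
  ultimately show "\<exists>t\<in>\<rat> \<inter> {t. 0 \<le> t \<and> ennreal t < a}. \<exists>s\<in>\<rat> \<inter> {0..t}. X t \<omega> + ereal \<delta> < X s \<omega>"
    using q r ts by (intro bexI[of _ q] bexI[of _ r]) auto
qed

lemma drawdown_time_less_pred:
  assumes "space G = space M" "\<And>s. 0 \<le> s \<Longrightarrow> ennreal s < a \<Longrightarrow> X s \<in> borel_measurable G"
  shows "Measurable.pred G (\<lambda>\<omega>. drawdown_time X \<delta> \<omega> < a)"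
proof (subst measurable_cong[OF drawdown_time_less_iff_rat])
  show "Measurable.pred G (\<lambda>\<omega>. \<exists>t\<in>\<rat> \<inter> {t. 0 \<le> t \<and> ennreal t < a}. \<exists>s\<in>\<rat> \<inter> {0..t}. X t \<omega> + ereal \<delta> < X s \<omega>)"
  proof (intro measurable_pred_countable countable_Int1 countable_rat)
    fix t s assume "t \<in> \<rat> \<inter> {t. 0 \<le> t \<and> ennreal t < a}" "s \<in> \<rat> \<inter> {0..t}"
    then have "0 \<le> t" "ennreal t < a" "0 \<le> s" "s \<le> t" by auto
    moreover then have "ennreal s < a" by (meson ennreal_leI le_less_trans)
    ultimately have [measurable]: "X t \<in> borel_measurable G" "X s \<in> borel_measurable G"
      by (auto intro: assms(2))
    show "Measurable.pred G (\<lambda>\<omega>. X t \<omega> + ereal \<delta> < X s \<omega>)" by measurable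
  qed
qed (auto simp: assms(1))

lemma measurable_drawdown_time: "drawdown_time X \<delta> \<in> borel_measurable M"
proof (rule borel_measurableI_less)
  show "{\<omega> \<in> space M. drawdown_time X \<delta> \<omega> < a} \<in> sets M" for a
    using drawdown_time_less_pred[OF refl measurable_X] by (auto simp: pred_def)
qed

lemma measurable_drawdown_max: "drawdown_max X \<delta> \<in> borel_measurable M"
proof -
  have [measurable]: "drawdown_time X \<delta> \<in> borel_measurable M" by (rule measurable_drawdown_time)
  have "(\<lambda>\<omega>. run_max X (max 0 (enn2real (drawdown_time X \<delta> \<omega>))) \<omega>) \<in> borel_measurable M"
    using measurable_compose[OF _ joint_measurable_run_max, of "\<lambda>\<omega>. (enn2real (drawdown_time X \<delta> \<omega>), \<omega>)" M]
    by simp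
  then have [measurable]: "(\<lambda>\<omega>. run_max X (enn2real (drawdown_time X \<delta> \<omega>)) \<omega>) \<in> borel_measurable M"
    by simp
  show ?thesis unfolding drawdown_max_def[abs_def] by measurable
qed

end

section \<open>Path space and the path after a drawdown\<close>

text \<open>Hitting times are infima over uncountably many times and so are not measurable for the product
\<open>\<sigma>\<close>-algebra on all functions; on its trace on the possible paths they are.\<close>
definition path_space :: "(real \<Rightarrow> ereal) measure" where
  "path_space = restrict_space (PiM {0..} (\<lambda>_. borel))
     {w. continuous_on {0..} w \<and> (\<forall>t\<ge>0. w t \<noteq> -\<infinity>) \<and> (\<forall>s t. 0 \<le> s \<and> s \<le> t \<and> w s = \<infinity> \<longrightarrow> w t = \<infinity>)}"

abbreviation (input) coord :: "real \<Rightarrow> (real \<Rightarrow> ereal) \<Rightarrow> ereal" where "coord \<equiv> \<lambda>t w. w t"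

lemma space_path_space:
  "w \<in> space path_space \<longleftrightarrow> w \<in> extensional {0..} \<and> continuous_on {0..} w \<and> (\<forall>t\<ge>0. w t \<noteq> -\<infinity>) \<and>
     (\<forall>s t. 0 \<le> s \<and> s \<le> t \<and> w s = \<infinity> \<longrightarrow> w t = \<infinity>)"
  by (auto simp: path_space_def space_restrict_space space_PiM PiE_def)

interpretation W: path_process path_space coord
proof
  fix t :: real assume "0 \<le> t"
  then show "coord t \<in> borel_measurable path_space"
    unfolding path_space_def by (intro measurable_restrict_space1 measurable_component_singleton) auto
qed (auto simp: space_path_space)

lemma path_from_apply: "0 \<le> s \<Longrightarrow> path_from X u \<omega> s = X (u + s) \<omega>"
  by (simp add: path_from_def)

lemma path_from_path_from:
  "0 \<le> v \<Longrightarrow> path_from coord v (path_from X u \<omega>) = path_from X (u + v) \<omega>"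
  by (auto simp: path_from_def fun_eq_iff add.assoc)

lemma path_functionals_path_from_0:
  "hit coord y (path_from X 0 \<omega>) = hit X y \<omega>"
  "drawdown_time coord \<delta> (path_from X 0 \<omega>) = drawdown_time X \<delta> \<omega>"
  "drawdown_max coord \<delta> (path_from X 0 \<omega>) = drawdown_max X \<delta> \<omega>"
proof -
  have r: "run_max coord t (path_from X 0 \<omega>) = run_max X t \<omega>" for t
    unfolding run_max_def by (intro SUP_cong refl) (auto simp: path_from_apply)
  show "hit coord y (path_from X 0 \<omega>) = hit X y \<omega>"
    unfolding hit_def by (intro arg_cong[where f=Inf] Collect_cong ex_cong1 conj_cong refl) (simp add: path_from_apply)
  show d: "drawdown_time coord \<delta> (path_from X 0 \<omega>) = drawdown_time X \<delta> \<omega>"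
    unfolding drawdown_time_def r
    by (intro arg_cong[where f=Inf] Collect_cong ex_cong1 conj_cong refl) (simp_all add: path_from_apply)
  show "drawdown_max coord \<delta> (path_from X 0 \<omega>) = drawdown_max X \<delta> \<omega>"
    unfolding drawdown_max_def d r ..
qed

definition crosses_down :: "(real \<Rightarrow> ereal) \<Rightarrow> real \<Rightarrow> bool" where
  "crosses_down v z \<longleftrightarrow> (\<forall>e>0. \<exists>r\<ge>0. r < e \<and> v r < ereal z)"

context path_process
begin

lemma path_from_in_path_space:
  assumes "\<omega> \<in> space M" "0 \<le> u"
  shows "path_from X u \<omega> \<in> space path_space"
  unfolding space_path_space
proof (intro conjI allI impI)
  show "path_from X u \<omega> \<in> extensional {0..}" by (simp add: path_from_def)
  have "continuous_on {0..} (\<lambda>s. X (u + s) \<omega>)"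
    using assms by (intro continuous_on_compose2[OF continuous_X[OF assms(1)], of _ "\<lambda>s. u + s"])
      (auto intro!: continuous_intros)
  then show "continuous_on {0..} (path_from X u \<omega>)"
    by (rule continuous_on_eq) (simp add: path_from_apply)
  show "path_from X u \<omega> t \<noteq> -\<infinity>" if "0 \<le> t" for t
    using that assms not_minf[of \<omega> "u + t"] by (simp add: path_from_apply)
  show "path_from X u \<omega> t = \<infinity>" if "0 \<le> s \<and> s \<le> t \<and> path_from X u \<omega> s = \<infinity>" for s t
    using that assms absorbed[of \<omega> "u + s" "u + t"] by (auto simp: path_from_apply)
qed

lemma joint_measurable_path_from:
  "(\<lambda>(u, \<omega>). path_from X (max 0 u) \<omega>) \<in> borel \<Otimes>\<^sub>M M \<rightarrow>\<^sub>M path_space"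
proof -
  have "(\<lambda>p. path_from X (max 0 (fst p)) (snd p)) \<in> borel \<Otimes>\<^sub>M M \<rightarrow>\<^sub>M path_space"
    unfolding path_space_def
  proof (rule measurable_restrict_space2)
    show "(\<lambda>p. path_from X (max 0 (fst p)) (snd p)) \<in> borel \<Otimes>\<^sub>M M \<rightarrow>\<^sub>M (\<Pi>\<^sub>M i\<in>{0..}. borel)"
      unfolding path_from_def
    proof (rule measurable_restrict)
      fix s :: real assume "s \<in> {0..}"
      then have "max 0 (max 0 u + s) = max 0 u + s" for u by auto
      then show "(\<lambda>p. X (max 0 (fst p) + s) (snd p)) \<in> borel_measurable (borel \<Otimes>\<^sub>M M)"
        using measurable_compose[OF _ joint_measurable_X, of "\<lambda>p. (max 0 (fst p) + s, snd p)" "borel \<Otimes>\<^sub>M M"]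
        by simp
    qed
  next
    have "path_from X (max 0 (fst p)) (snd p) \<in> space path_space" if "p \<in> space (borel \<Otimes>\<^sub>M M)" for p
      using that by (intro path_from_in_path_space) (auto simp: space_pair_measure)
    then show "(\<lambda>p. path_from X (max 0 (fst p)) (snd p)) \<in> space (borel \<Otimes>\<^sub>M M) \<rightarrow>
        {w. continuous_on {0..} w \<and> (\<forall>t\<ge>0. w t \<noteq> - \<infinity>) \<and>
            (\<forall>s t. 0 \<le> s \<and> s \<le> t \<and> w s = \<infinity> \<longrightarrow> w t = \<infinity>)}"
      unfolding space_path_space Pi_iff mem_Collect_eq by blast
  qed
  then show ?thesis by (simp add: split_beta')
qed

lemma measurable_path_from:
  assumes "T \<in> borel_measurable M"
  shows "(\<lambda>\<omega>. path_from X (enn2real (T \<omega>)) \<omega>) \<in> M \<rightarrow>\<^sub>M path_space"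
  using measurable_compose[OF _ joint_measurable_path_from, of "\<lambda>\<omega>. (enn2real (T \<omega>), \<omega>)" M] assms
  by simp

lemma measurable_path_from_0: "path_from X 0 \<in> M \<rightarrow>\<^sub>M path_space"
  using measurable_path_from[of "\<lambda>_. 0"] by simp

lemma le_before_hit:
  assumes "\<omega> \<in> space M" "0 \<le> t" "ennreal t \<le> hit X y \<omega>" "X 0 \<omega> \<le> ereal y"
  shows "X t \<omega> \<le> ereal y"
proof (rule ccontr)
  assume n: "\<not> ?thesis"
  have "X 0 \<omega> \<le> ereal y \<and> ereal y \<le> X t \<omega> \<or> X t \<omega> \<le> ereal y \<and> ereal y \<le> X 0 \<omega>"
    using n assms(4) by auto
  then obtain s where s: "0 \<le> s" "s \<le> t" "X s \<omega> = ereal y"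
    by (rule X_IVT[OF assms(1) order_refl assms(2)])
  have "ennreal t \<le> ennreal s" using assms(3) hit_le[OF s(1,3)] by (rule order_trans)
  then have "s = t" using s by (simp add: ennreal_le_iff)
  then show False using n s by simp
qed

lemma ge_before_hit:
  assumes "\<omega> \<in> space M" "0 \<le> t" "ennreal t \<le> hit X y \<omega>" "ereal y \<le> X 0 \<omega>"
  shows "ereal y \<le> X t \<omega>"
proof (rule ccontr)
  assume n: "\<not> ?thesis"
  have "X 0 \<omega> \<le> ereal y \<and> ereal y \<le> X t \<omega> \<or> X t \<omega> \<le> ereal y \<and> ereal y \<le> X 0 \<omega>"
    using n assms(4) by auto
  then obtain s where s: "0 \<le> s" "s \<le> t" "X s \<omega> = ereal y"
    by (rule X_IVT[OF assms(1) order_refl assms(2)])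
  have "ennreal t \<le> ennreal s" using assms(3) hit_le[OF s(1,3)] by (rule order_trans)
  then have "s = t" using s by (simp add: ennreal_le_iff)
  then show False using n s by simp
qed

lemma drawdown_time_le:
  assumes "\<omega> \<in> space M" "0 \<le> s" "s \<le> t" "X t \<omega> + ereal \<delta> < X s \<omega>"
  shows "drawdown_time X \<delta> \<omega> \<le> ennreal t"
  unfolding drawdown_time_eq[OF assms(1)]
  by (intro Inf_lower CollectI exI[of _ t] conjI bexI[of _ s]) (use assms in auto)

lemma no_drawdown_before:
  assumes "\<omega> \<in> space M" "0 \<le> s" "s \<le> t" "ennreal t < drawdown_time X \<delta> \<omega>"
  shows "X s \<omega> \<le> X t \<omega> + ereal \<delta>"
proof (rule ccontr)
  assume "\<not> ?thesis"
  then have "drawdown_time X \<delta> \<omega> \<le> ennreal t"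
    using drawdown_time_le[OF assms(1-3)] by (simp add: not_le)
  with assms(4) show False by simp
qed

lemma drawdown_time_ge:
  assumes "\<omega> \<in> space M" "\<And>s t. 0 \<le> s \<Longrightarrow> s \<le> t \<Longrightarrow> ennreal t < a \<Longrightarrow> X s \<omega> \<le> X t \<omega> + ereal \<delta>"
  shows "a \<le> drawdown_time X \<delta> \<omega>"
proof (rule ccontr)
  assume "\<not> ?thesis"
  then obtain t s where "0 \<le> s" "s \<le> t" "ennreal t < a" "X t \<omega> + ereal \<delta> < X s \<omega>"
    unfolding not_le drawdown_time_less_iff[OF assms(1)] by auto
  then show False using assms(2)[of s t] by simp
qed

lemma drawdown_time_mono:
  assumes "\<omega> \<in> space M" "\<rho> \<le> \<delta>"
  shows "drawdown_time X \<rho> \<omega> \<le> drawdown_time X \<delta> \<omega>"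
proof (rule drawdown_time_ge[OF assms(1)])
  fix s t assume st: "0 \<le> s" "s \<le> t" "ennreal t < drawdown_time X \<rho> \<omega>"
  have "X s \<omega> \<le> X t \<omega> + ereal \<rho>" by (rule no_drawdown_before[OF assms(1) st])
  also have "\<dots> \<le> X t \<omega> + ereal \<delta>" using assms(2) by (intro add_left_mono) simp
  finally show "X s \<omega> \<le> X t \<omega> + ereal \<delta>" .
qed

text \<open>At a finite drawdown time the path is alive and the drawdown equals \<open>\<rho>\<close> exactly: it is at least \<open>\<rho>\<close> by
right-continuity and at most \<open>\<rho>\<close> by left-continuity, or because it vanishes at time \<open>0\<close>.\<close>
lemma drawdown_time_state:
  assumes "\<omega> \<in> space M" "0 \<le> \<rho>" "drawdown_time X \<rho> \<omega> = ennreal u" "0 \<le> u"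
  obtains y where "run_max X u \<omega> = ereal y" "X u \<omega> = ereal (y - \<rho>)" "drawdown_max X \<rho> \<omega> = y"
    "\<And>s t. 0 \<le> s \<Longrightarrow> s \<le> t \<Longrightarrow> t \<le> u \<Longrightarrow> X s \<omega> \<le> X t \<omega> + ereal \<rho>"
proof -
  have "X u \<omega> \<noteq> \<infinity>"
  proof
    assume inf: "X u \<omega> = \<infinity>"
    obtain s t where ts: "0 \<le> s" "s \<le> t" "X t \<omega> + ereal \<rho> < X s \<omega>"
      using drawdown_time_less_iff[OF assms(1), of \<rho> top] assms(3) by auto
    then have "ennreal u \<le> ennreal t"
      unfolding assms(3)[symmetric] by (rule drawdown_time_le[OF assms(1)])
    then have "u \<le> t" using ts by (simp add: ennreal_le_iff)
    then have "X t \<omega> = \<infinity>" using absorbed[OF assms(1,4) _ inf] by simp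
    then show False using ts by simp
  qed
  then obtain x where x: "X u \<omega> = ereal x" using not_minf[OF assms(1,4)] by (cases "X u \<omega>") auto
  have up: "X s \<omega> \<le> ereal (x + \<rho>)" if s: "0 \<le> s" "s \<le> u" for s
  proof (rule ccontr)
    assume n: "\<not> ?thesis"
    then have "s \<noteq> u" using x assms(2) by auto
    then have su: "s < u" using s by simp
    obtain c where c: "ereal (x + \<rho>) < ereal c" "ereal c < X s \<omega>"
      using ereal_dense2[of "ereal (x + \<rho>)" "X s \<omega>"] n by (meson not_le)
    obtain e where e: "e > 0" "\<And>r. 0 \<le> r \<Longrightarrow> \<bar>r - u\<bar> < e \<Longrightarrow> X r \<omega> < ereal (c - \<rho>)"
      using X_near_open[OF assms(1,4), of "{..<ereal (c - \<rho>)}"] x c(1) by auto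
    \<comment> \<open>A time in \<open>[s, u)\<close> that is close enough to \<open>u\<close>.\<close>
    define r where "r = max s (u - e / 2)"
    have r: "s \<le> r" "r < u" "\<bar>r - u\<bar> < e" using su e(1) by (auto simp: r_def)
    have "X s \<omega> \<le> X r \<omega> + ereal \<rho>"
      using r s assms(3) by (intro no_drawdown_before[OF assms(1)]) (auto simp: ennreal_less_iff)
    moreover have "X r \<omega> < ereal (c - \<rho>)" using r s by (intro e(2)) auto
    then have "X r \<omega> + ereal \<rho> < ereal c" by (cases "X r \<omega>") auto
    ultimately show False using c(2) by auto
  qed
  have max: "run_max X u \<omega> = ereal (x + \<rho>)"
  proof (rule antisym)
    show "run_max X u \<omega> \<le> ereal (x + \<rho>)" unfolding run_max_def by (intro SUP_least) (auto intro: up)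
    show "ereal (x + \<rho>) \<le> run_max X u \<omega>"
    proof (rule ccontr)
      assume "\<not> ?thesis"
      then have "run_max X u \<omega> < ereal (x + \<rho>)" by simp
      then obtain c where c: "run_max X u \<omega> < ereal c" "ereal c < ereal (x + \<rho>)"
        using ereal_dense2 by blast
      have "X u \<omega> < ereal c" using run_max_ge[OF assms(4) order_refl, of \<omega>] c(1) by simp
      then obtain e where e: "e > 0" "\<And>r. 0 \<le> r \<Longrightarrow> \<bar>r - u\<bar> < e \<Longrightarrow> X r \<omega> \<in> {ereal (c - \<rho>)<..<ereal c}"
        using X_near_open[OF assms(1,4), of "{ereal (c - \<rho>)<..<ereal c}"] x c(2) by auto
      have "ennreal (u + e) \<le> drawdown_time X \<rho> \<omega>"
      proof (rule drawdown_time_ge[OF assms(1)])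
        fix s t assume st: "0 \<le> s" "s \<le> t" "ennreal t < ennreal (u + e)"
        then have t: "t < u + e" by (simp add: ennreal_less_iff)
        show "X s \<omega> \<le> X t \<omega> + ereal \<rho>"
        proof (cases "t < u")
          case True
          then show ?thesis using st assms(3) by (intro no_drawdown_before[OF assms(1)]) (auto simp: ennreal_less_iff)
        next
          case False
          then have "X t \<omega> \<in> {ereal (c - \<rho>)<..<ereal c}" using t st by (intro e(2)) auto
          then have "ereal c \<le> X t \<omega> + ereal \<rho>" by (cases "X t \<omega>") auto
          moreover have "X s \<omega> < ereal c"
          proof (cases "s \<le> u")
            case True then show ?thesis using run_max_ge[OF st(1), of u \<omega>] c(1) by auto
          next
            case False then show ?thesis using e(2)[of s] st t by auto
          qed
          ultimately show ?thesis by (auto intro: less_imp_le order_trans)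
        qed
      qed
      then show False unfolding assms(3) using e(1) assms(4) by (simp add: ennreal_le_iff)
    qed
  qed
  show thesis
  proof (rule that[of "x + \<rho>"])
    show "run_max X u \<omega> = ereal (x + \<rho>)" by fact
    show "X u \<omega> = ereal (x + \<rho> - \<rho>)" using x by simp
    show "drawdown_max X \<rho> \<omega> = x + \<rho>" using max assms(3,4) by (simp add: drawdown_max_def)
    fix s t assume st: "0 \<le> s" "s \<le> t" "t \<le> u"
    show "X s \<omega> \<le> X t \<omega> + ereal \<rho>"
    proof (cases "t < u")
      case True
      then show ?thesis using st assms(3) by (intro no_drawdown_before[OF assms(1)]) (auto simp: ennreal_less_iff)
    next
      case False then show ?thesis using st up[of s] x by simp
    qed
  qed
qed

text \<open>At a time \<open>u\<close> where the path is at its maximum, every earlier value is dominated by the value at \<open>u\<close>.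
Drawdowns and maxima after \<open>u\<close> are therefore those of the path after \<open>u\<close>.\<close>
lemma drawdown_restart:
  assumes "\<omega> \<in> space M" "0 \<le> u"
    and top: "run_max X u \<omega> = X u \<omega>"
    and none: "\<And>s t. 0 \<le> s \<Longrightarrow> s \<le> t \<Longrightarrow> t \<le> u \<Longrightarrow> X s \<omega> \<le> X t \<omega> + ereal \<delta>"
  shows "drawdown_time X \<delta> \<omega> = ennreal u + drawdown_time coord \<delta> (path_from X u \<omega>)"
    and "drawdown_time X \<delta> \<omega> < \<infinity> \<Longrightarrow> drawdown_max X \<delta> \<omega> = drawdown_max coord \<delta> (path_from X u \<omega>)"
proof -
  let ?v = "path_from X u \<omega>"
  have v: "?v \<in> space path_space" by (rule path_from_in_path_space[OF assms(1,2)])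
  show t: "drawdown_time X \<delta> \<omega> = ennreal u + drawdown_time coord \<delta> ?v"
  proof (rule antisym)
    show "drawdown_time X \<delta> \<omega> \<le> ennreal u + drawdown_time coord \<delta> ?v"
    proof (rule ccontr)
      assume "\<not> ?thesis"
      then have "drawdown_time coord \<delta> ?v < drawdown_time X \<delta> \<omega> - ennreal u"
        by (subst less_diff_eq_ennreal) (auto simp: not_le add.commute)
      then obtain t s where st: "0 \<le> s" "s \<le> t" "ennreal t < drawdown_time X \<delta> \<omega> - ennreal u"
          "?v t + ereal \<delta> < ?v s"
        unfolding W.drawdown_time_less_iff[OF v] by auto
      from st(3) have "ennreal (u + t) < drawdown_time X \<delta> \<omega>"
        using st assms(2) by (subst (asm) less_diff_eq_ennreal) (auto simp: add.commute)
      from no_drawdown_before[OF assms(1) _ _ this, of "u + s"] st assms(2)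
      show False by (auto simp: path_from_apply)
    qed
    show "ennreal u + drawdown_time coord \<delta> ?v \<le> drawdown_time X \<delta> \<omega>"
    proof (rule drawdown_time_ge[OF assms(1)])
      fix s t assume st: "0 \<le> s" "s \<le> t" "ennreal t < ennreal u + drawdown_time coord \<delta> ?v"
      show "X s \<omega> \<le> X t \<omega> + ereal \<delta>"
      proof (cases "t \<le> u")
        case True then show ?thesis using st none by auto
      next
        case False
        then have "ennreal t = ennreal u + ennreal (t - u)" using assms(2) by (simp flip: ennreal_plus)
        with st(3) have l: "ennreal (t - u) < drawdown_time coord \<delta> ?v"
          by (simp add: ennreal_add_left_cancel_less)
        \<comment> \<open>A time \<open>s\<close> before \<open>u\<close> may be replaced by \<open>u\<close>, where the path is at its maximum.\<close>
        have "X (max s u) \<omega> \<le> X t \<omega> + ereal \<delta>"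
          using W.no_drawdown_before[OF v _ _ l, of "max s u - u"] False st
          by (auto simp: path_from_apply)
        moreover have "X s \<omega> \<le> X (max s u) \<omega>"
          using run_max_ge[OF st(1), of u \<omega>] top by (auto simp: max_def)
        ultimately show ?thesis by simp
      qed
    qed
  qed
  assume "drawdown_time X \<delta> \<omega> < \<infinity>"
  then have fin: "drawdown_time coord \<delta> ?v < \<infinity>" unfolding t by simp
  have "run_max X (u + r) \<omega> = run_max coord r ?v" if "0 \<le> r" for r
  proof (rule antisym)
    show "run_max X (u + r) \<omega> \<le> run_max coord r ?v"
      unfolding run_max_def
    proof (rule SUP_least)
      fix s assume s: "s \<in> {0..u + r}"
      have "X s \<omega> \<le> X (max s u) \<omega>"
        using run_max_ge[of s u \<omega>] s top by (auto simp: max_def)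
      also have "\<dots> = ?v (max s u - u)" using s by (simp add: path_from_apply)
      also have "\<dots> \<le> (SUP s\<in>{0..r}. ?v s)" using s that by (intro SUP_upper) auto
      finally show "X s \<omega> \<le> (SUP s\<in>{0..r}. ?v s)" .
    qed
    show "run_max coord r ?v \<le> run_max X (u + r) \<omega>"
      unfolding run_max_def using assms(2)
      by (intro SUP_least) (auto simp: path_from_apply intro!: SUP_upper)
  qed
  moreover have "enn2real (drawdown_time X \<delta> \<omega>) = u + enn2real (drawdown_time coord \<delta> ?v)"
    unfolding t using fin assms(2) by (simp add: enn2real_plus)
  ultimately show "drawdown_max X \<delta> \<omega> = drawdown_max coord \<delta> ?v"
    unfolding drawdown_max_def by simp
qed

text \<open>The starting value \<open>y - \<rho>\<close> lies in the corridor from \<open>y - \<delta>\<close> to \<open>y\<close>, which a continuous path cannot leave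
before it hits one of the boundaries.\<close>
lemma corridor_after_drawdown:
  assumes "\<omega> \<in> space M" "0 \<le> \<rho>" "\<rho> < \<delta>" "drawdown_time X \<rho> \<omega> = ennreal u" "0 \<le> u"
    and w: "w = path_from X u \<omega>" and y: "y = drawdown_max X \<rho> \<omega>"
    and h: "0 \<le> h" "ennreal h \<le> hit coord (y - \<delta>) w" "ennreal h \<le> hit coord y w"
  shows "run_max X (u + h) \<omega> = ereal y"
    and "\<And>s t. 0 \<le> s \<Longrightarrow> s \<le> t \<Longrightarrow> t \<le> u + h \<Longrightarrow> X s \<omega> \<le> X t \<omega> + ereal \<delta>"
    and "\<exists>s\<ge>0. s \<le> u \<and> X s \<omega> = ereal y"
proof -
  have wW: "w \<in> space path_space" unfolding w by (rule path_from_in_path_space[OF assms(1,5)])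
  obtain max: "run_max X u \<omega> = ereal y" and Xu: "X u \<omega> = ereal (y - \<rho>)"
    and pre: "\<And>s t. 0 \<le> s \<Longrightarrow> s \<le> t \<Longrightarrow> t \<le> u \<Longrightarrow> X s \<omega> \<le> X t \<omega> + ereal \<rho>"
    using drawdown_time_state[OF assms(1,2,4,5)] y by metis
  have w0: "w 0 = ereal (y - \<rho>)" using Xu by (simp add: w path_from_apply)
  have cor: "ereal (y - \<delta>) \<le> X t \<omega>" "X t \<omega> \<le> ereal y" if t: "u \<le> t" "t \<le> u + h" for t
  proof -
    have "ennreal (t - u) \<le> ennreal h" using t by (intro ennreal_leI) auto
    then have l: "ennreal (t - u) \<le> hit coord (y - \<delta>) w" "ennreal (t - u) \<le> hit coord y w"
      using h(2,3) by (blast intro: order_trans)+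
    have "ereal (y - \<delta>) \<le> w (t - u)" using W.ge_before_hit[OF wW _ l(1)] t(1) w0 assms(3) by simp
    moreover have "w (t - u) \<le> ereal y" using W.le_before_hit[OF wW _ l(2)] t(1) w0 assms(2) by simp
    ultimately show "ereal (y - \<delta>) \<le> X t \<omega>" "X t \<omega> \<le> ereal y" using t by (simp_all add: w path_from_apply)
  qed
  have le: "X s \<omega> \<le> ereal y" if "0 \<le> s" "s \<le> u + h" for s
    using that cor(2)[of s] run_max_ge[of s u \<omega>] max by (cases "s \<le> u") auto
  obtain s where s: "0 \<le> s" "s \<le> u" "X s \<omega> = ereal y"
    using run_max_attained[OF assms(1,5)] max by metis
  then show "\<exists>s\<ge>0. s \<le> u \<and> X s \<omega> = ereal y" by auto
  show "run_max X (u + h) \<omega> = ereal y"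
  proof (rule antisym)
    show "run_max X (u + h) \<omega> \<le> ereal y" unfolding run_max_def by (intro SUP_least) (auto intro: le)
    show "ereal y \<le> run_max X (u + h) \<omega>" using run_max_ge[of s "u + h" \<omega>] s h(1) by auto
  qed
  show "X s \<omega> \<le> X t \<omega> + ereal \<delta>" if st: "0 \<le> s" "s \<le> t" "t \<le> u + h" for s t
  proof (cases "t \<le> u")
    case True
    have "X s \<omega> \<le> X t \<omega> + ereal \<rho>" using pre st(1,2) True by auto
    also have "\<dots> \<le> X t \<omega> + ereal \<delta>" using assms(3) by (intro add_left_mono) auto
    finally show ?thesis .
  next
    case False
    have "X s \<omega> \<le> ereal y" using le st by auto
    also have "ereal y \<le> X t \<omega> + ereal \<delta>" using cor(1)[of t] False st by (cases "X t \<omega>") auto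
    finally show ?thesis .
  qed
qed

text \<open>When the path hits \<open>y - \<delta>\<close> the drawdown is equal to \<open>\<delta>\<close>, whereas the drawdown time requires it to be
strictly larger; the crossing hypothesis closes this gap.\<close>
lemma drawdown_if_lower_first:
  assumes "\<omega> \<in> space M" "0 \<le> \<rho>" "\<rho> < \<delta>" "drawdown_time X \<rho> \<omega> = ennreal u" "0 \<le> u"
    and w: "w = path_from X u \<omega>" and y: "y = drawdown_max X \<rho> \<omega>"
    and lt: "hit coord (y - \<delta>) w < hit coord y w"
    and cross: "crosses_down (path_from coord (enn2real (hit coord (y - \<delta>) w)) w) (y - \<delta>)"
  shows "drawdown_time X \<delta> \<omega> = ennreal (u + enn2real (hit coord (y - \<delta>) w))"
    and "drawdown_max X \<delta> \<omega> = y"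
proof -
  define h where "h = enn2real (hit coord (y - \<delta>) w)"
  have h: "0 \<le> h" "ennreal h = hit coord (y - \<delta>) w"
    using less_le_trans[OF lt top_greatest] by (simp_all add: h_def)
  note c = corridor_after_drawdown[OF assms(1-7) h(1)]
  have le: "ennreal h \<le> hit coord (y - \<delta>) w" "ennreal h \<le> hit coord y w" using h lt by auto
  have t: "drawdown_time X \<delta> \<omega> = ennreal (u + h)"
  proof (rule antisym)
    show "ennreal (u + h) \<le> drawdown_time X \<delta> \<omega>"
      using c(2)[OF le] assms(5) h(1) by (intro drawdown_time_ge[OF assms(1)])
        (auto simp: ennreal_less_iff simp del: ennreal_plus)
    show "drawdown_time X \<delta> \<omega> \<le> ennreal (u + h)"
    proof (rule ccontr)
      assume "\<not> ?thesis"
      then obtain b :: rat where b: "ennreal (u + h) < ennreal (real_of_rat b)"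
          "ennreal (real_of_rat b) < drawdown_time X \<delta> \<omega>"
        using ennreal_rat_dense[of "ennreal (u + h)" "drawdown_time X \<delta> \<omega>"] by (meson not_le)
      then have "u + h < real_of_rat b"
        using assms(5) h(1) by (simp add: ennreal_less_iff del: ennreal_plus)
      then obtain r where r: "0 \<le> r" "r < real_of_rat b - (u + h)" "path_from coord h w r < ereal (y - \<delta>)"
        using cross[unfolded crosses_down_def, rule_format, of "real_of_rat b - (u + h)"] by (auto simp: h_def)
      then have *: "X (u + h + r) \<omega> < ereal (y - \<delta>)"
        using h(1) by (simp add: w path_from_path_from path_from_apply)
      obtain s where s: "0 \<le> s" "s \<le> u" "X s \<omega> = ereal y" using c(3)[OF le] by auto
      have "ennreal (u + h + r) \<le> ennreal (real_of_rat b)" using r by (intro ennreal_leI) auto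
      then have "X s \<omega> \<le> X (u + h + r) \<omega> + ereal \<delta>"
        using b(2) s h(1) r(1) by (intro no_drawdown_before[OF assms(1)]) auto
      with * s show False by (cases "X (u + h + r) \<omega>") auto
    qed
  qed
  then show "drawdown_time X \<delta> \<omega> = ennreal (u + enn2real (hit coord (y - \<delta>) w))" by (simp add: h_def)
  show "drawdown_max X \<delta> \<omega> = y"
    unfolding drawdown_max_def t using c(1)[OF le] h(1) assms(5) by (simp del: ennreal_plus)
qed

text \<open>On hitting \<open>y\<close> the path is back at its maximum, and the drawdown starts afresh.\<close>
lemma drawdown_if_upper_first:
  assumes "\<omega> \<in> space M" "0 \<le> \<rho>" "\<rho> < \<delta>" "drawdown_time X \<rho> \<omega> = ennreal u" "0 \<le> u"
    and w: "w = path_from X u \<omega>" and y: "y = drawdown_max X \<rho> \<omega>"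
    and lt: "hit coord y w < hit coord (y - \<delta>) w"
    and h: "h = enn2real (hit coord y w)"
  shows "drawdown_time X \<delta> \<omega> = ennreal (u + h) + drawdown_time coord \<delta> (path_from coord h w)"
    and "drawdown_time X \<delta> \<omega> < \<infinity> \<Longrightarrow> drawdown_max X \<delta> \<omega> = drawdown_max coord \<delta> (path_from coord h w)"
proof -
  have h': "0 \<le> h" "ennreal h = hit coord y w"
    using less_le_trans[OF lt top_greatest] by (simp_all add: h)
  note c = corridor_after_drawdown[OF assms(1-7) h'(1)]
  have le: "ennreal h \<le> hit coord (y - \<delta>) w" "ennreal h \<le> hit coord y w" using h' lt by auto
  have wW: "w \<in> space path_space" unfolding w by (rule path_from_in_path_space[OF assms(1,5)])
  have "w h = ereal y" using W.X_hit[OF wW, of y] less_le_trans[OF lt top_greatest] h by simp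
  then have "X (u + h) \<omega> = ereal y" using h'(1) by (simp add: w path_from_apply)
  then have "run_max X (u + h) \<omega> = X (u + h) \<omega>" using c(1)[OF le] by simp
  note r = drawdown_restart[OF assms(1) _ this c(2)[OF le]]
  have eq: "path_from coord h w = path_from X (u + h) \<omega>"
    using h'(1) by (simp add: w path_from_path_from)
  show "drawdown_time X \<delta> \<omega> = ennreal (u + h) + drawdown_time coord \<delta> (path_from coord h w)"
    unfolding eq using r(1) h'(1) assms(5) by auto
  show "drawdown_max X \<delta> \<omega> = drawdown_max coord \<delta> (path_from coord h w)" if "drawdown_time X \<delta> \<omega> < \<infinity>"
    unfolding eq using r(2) that h'(1) assms(5) by auto
qed

text \<open>A path that hits neither boundary stays in the corridor forever and never has a drawdown above \<open>\<delta>\<close>.\<close>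
lemma hit_order_after_drawdown:
  assumes "\<omega> \<in> space M" "0 \<le> \<rho>" "\<rho> < \<delta>" "drawdown_time X \<rho> \<omega> = ennreal u" "0 \<le> u"
    and w: "w = path_from X u \<omega>" and y: "y = drawdown_max X \<rho> \<omega>"
    and fin: "drawdown_time X \<delta> \<omega> < \<infinity>"
  shows "hit coord (y - \<delta>) w < hit coord y w \<or> hit coord y w < hit coord (y - \<delta>) w"
proof (rule ccontr)
  assume "\<not> ?thesis"
  then have eq: "hit coord (y - \<delta>) w = hit coord y w" by auto
  have wW: "w \<in> space path_space" unfolding w by (rule path_from_in_path_space[OF assms(1,5)])
  have inf: "hit coord y w = \<infinity>"
  proof (rule ccontr)
    assume "hit coord y w \<noteq> \<infinity>"
    then have "hit coord y w < \<infinity>" by (simp add: less_top)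
    then show False using W.X_hit[OF wW, of y] W.X_hit[OF wW, of "y - \<delta>"] eq assms(2,3) by auto
  qed
  have "\<infinity> \<le> drawdown_time X \<delta> \<omega>"
  proof (rule drawdown_time_ge[OF assms(1)])
    fix s t :: real assume "0 \<le> s" "s \<le> t"
    then show "X s \<omega> \<le> X t \<omega> + ereal \<delta>"
      using corridor_after_drawdown(2)[OF assms(1-7), of t] inf eq assms(5) by auto
  qed
  with fin show False by simp
qed

end

section \<open>Stopping times and their sigma-algebras\<close>

lemma sets_natural_filtration:
  "sets (natural_filtration M X t) =
     sigma_sets (space M) (\<Union>s\<in>{s. 0 \<le> s \<and> ennreal s \<le> t}. {X s -` B \<inter> space M |B. B \<in> sets borel})"
  unfolding natural_filtration_def by (rule sets_measure_of) auto

lemma measurable_natural_filtration: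
  assumes "0 \<le> s" "ennreal s \<le> t"
  shows "X s \<in> borel_measurable (natural_filtration M X t)"
proof (rule measurableI)
  show "X s -` B \<inter> space (natural_filtration M X t) \<in> sets (natural_filtration M X t)" if "B \<in> sets borel" for B
    unfolding space_natural_filtration sets_natural_filtration
    using assms that by (intro sigma_sets.Basic) auto
qed auto

context path_process
begin

lemma sets_natural_filtration_mono:
  assumes "t \<le> t'"
  shows "sets (natural_filtration M X t) \<subseteq> sets (natural_filtration M X t')"
  unfolding sets_natural_filtration using assms
  by (intro sigma_sets_mono' UN_mono) (auto intro: order_trans)

lemma sets_natural_filtration_subset: "sets (natural_filtration M X t) \<subseteq> sets M"
  unfolding sets_natural_filtration using measurable_X
  by (intro sets.sigma_sets_subset) (auto intro: measurable_sets)

lemma path_process_natural_filtration: "path_process (natural_filtration M X \<top>) X"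
  by unfold_locales
    (auto simp: space_natural_filtration not_minf intro: measurable_natural_filtration continuous_X not_minf absorbed)

lemma space_right_filtration: "space (right_filtration M X t) = space M"
  by (rule filtration.space_F[OF filtration_right_filtration])

text \<open>The case \<open>t = s = \<top>\<close> accounts for the last member of the filtration, which has no successors.\<close>
lemma pred_right_filtrationI:
  assumes "\<And>s. t < s \<or> t = \<top> \<and> s = \<top> \<Longrightarrow> Measurable.pred (natural_filtration M X s) p"
  shows "Measurable.pred (right_filtration M X t) p"
  unfolding pred_def sets_right_filtration
proof (rule INT_I)
  fix s assume "s \<in> insert \<top> {t<..}"
  then have "t < s \<or> t = \<top> \<and> s = \<top>" by (cases "t = \<top>") (auto simp: top.not_eq_extremum)
  from assms[OF this] show "{x \<in> space (right_filtration M X t). p x} \<in> sets (natural_filtration M X s)"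
    by (simp add: pred_def space_right_filtration space_natural_filtration)
qed

lemma stopping_time_drawdown_time: "stopping_time (right_filtration M X) (drawdown_time X \<delta>)"
proof (rule stopping_timeI, rule pred_right_filtrationI)
  fix t s :: ennreal assume ts: "t < s \<or> t = \<top> \<and> s = \<top>"
  show "Measurable.pred (natural_filtration M X s) (\<lambda>\<omega>. drawdown_time X \<delta> \<omega> \<le> t)"
  proof (cases "t = \<top>")
    case False
    then have ts: "t < s" using ts by auto
    have "drawdown_time X \<delta> \<omega> \<le> t \<longleftrightarrow> (\<forall>q\<in>{q. t < ennreal (real_of_rat q) \<and> ennreal (real_of_rat q) < s}. drawdown_time X \<delta> \<omega> < ennreal (real_of_rat q))" for \<omega>
    proof
      assume *: "\<forall>q\<in>{q. t < ennreal (real_of_rat q) \<and> ennreal (real_of_rat q) < s}. drawdown_time X \<delta> \<omega> < ennreal (real_of_rat q)"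
      show "drawdown_time X \<delta> \<omega> \<le> t"
      proof (rule ccontr)
        assume "\<not> ?thesis"
        then have "t < min (drawdown_time X \<delta> \<omega>) s" using ts by auto
        then obtain q :: rat where "t < ennreal (real_of_rat q)" "ennreal (real_of_rat q) < min (drawdown_time X \<delta> \<omega>) s"
          using ennreal_rat_dense by blast
        with * show False by auto
      qed
    qed auto
    moreover have "Measurable.pred (natural_filtration M X s) (\<lambda>\<omega>. \<forall>q\<in>{q. t < ennreal (real_of_rat q) \<and> ennreal (real_of_rat q) < s}. drawdown_time X \<delta> \<omega> < ennreal (real_of_rat q))"
    proof (rule measurable_pred_countable)
      fix q assume q: "q \<in> {q. t < ennreal (real_of_rat q) \<and> ennreal (real_of_rat q) < s}"
      show "Measurable.pred (natural_filtration M X s) (\<lambda>\<omega>. drawdown_time X \<delta> \<omega> < ennreal (real_of_rat q))"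
      proof (rule drawdown_time_less_pred[OF space_natural_filtration])
        fix r :: real assume "0 \<le> r" "ennreal r < ennreal (real_of_rat q)"
        then show "X r \<in> borel_measurable (natural_filtration M X s)"
          using q by (intro measurable_natural_filtration) auto
      qed
    qed simp
    ultimately show ?thesis by (simp only:)
  qed simp
qed

lemma sets_natural_subset_right_filtration: "sets (natural_filtration M X t) \<subseteq> sets (right_filtration M X t)"
  unfolding sets_right_filtration by (intro INT_greatest sets_natural_filtration_mono) auto

lemma stopping_time_hit: "stopping_time (right_filtration M X) (hit X y)"
proof (rule stopping_timeI)
  fix t
  have "Measurable.pred (natural_filtration M X t) (\<lambda>\<omega>. hit X y \<omega> \<le> t)"
  proof (cases t)
    case (real r)
    have [measurable]: "run_max X r \<in> borel_measurable (natural_filtration M X t)" "run_min r \<in> borel_measurable (natural_filtration M X t)"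
      using real by (auto intro!: measurable_run_max_min measurable_natural_filtration space_natural_filtration ennreal_leI)
    have "Measurable.pred (natural_filtration M X t) (\<lambda>\<omega>. run_min r \<omega> \<le> ereal y \<and> ereal y \<le> run_max X r \<omega>)"
      by measurable
    then show ?thesis
      using real by (subst measurable_cong[where g="\<lambda>\<omega>. run_min r \<omega> \<le> ereal y \<and> ereal y \<le> run_max X r \<omega>"])
        (auto simp: space_natural_filtration hit_le_iff_run)
  qed simp
  then show "Measurable.pred (right_filtration M X t) (\<lambda>\<omega>. hit X y \<omega> \<le> t)"
    using sets_natural_subset_right_filtration by (auto simp: pred_def space_natural_filtration space_right_filtration)
qed

lemma space_stopped_sigma: "space (stopped_sigma M X T) = space M"
  unfolding stopped_sigma_def by (rule filtration.space_pre_sigma[OF filtration_right_filtration])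

lemma sets_stopped_sigma_subset:
  assumes "stopping_time (right_filtration M X) T"
  shows "sets (stopped_sigma M X T) \<subseteq> sets M"
proof
  fix A assume "A \<in> sets (stopped_sigma M X T)"
  from filtration.sets_pre_sigmaD[OF filtration_right_filtration assms this[unfolded stopped_sigma_def], of \<top>]
  have "A \<in> sets (right_filtration M X \<top>)" by simp
  then have "A \<in> sets (natural_filtration M X \<top>)" unfolding sets_right_filtration by blast
  then show "A \<in> sets M" using sets_natural_filtration_subset by blast
qed

lemma measurable_stopped_sigma_time:
  assumes "stopping_time (right_filtration M X) T"
  shows "T \<in> borel_measurable (stopped_sigma M X T)"
  unfolding stopped_sigma_def
  by (rule filtration.measurable_stopping_time_pre_sigma[OF filtration_right_filtration assms])

text \<open>The running maximum is right-continuous, so its value at the drawdown time can be tested at rational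
times shortly afterwards. Those times are before \<open>s\<close>, which makes the maximum at the drawdown time
measurable with respect to the right-continuous filtration.\<close>
lemma drawdown_max_less_iff:
  assumes "\<omega> \<in> space M" "0 \<le> \<rho>" "drawdown_time X \<rho> \<omega> \<le> t" "t < s"
  shows "drawdown_max X \<rho> \<omega> < c \<longleftrightarrow>
    (\<exists>q\<in>\<rat> \<inter> {q. 0 \<le> q \<and> ennreal q < s}. drawdown_time X \<rho> \<omega> < ennreal q \<and> run_max X q \<omega> < ereal c)"
proof -
  define u where "u = enn2real (drawdown_time X \<rho> \<omega>)"
  have "drawdown_time X \<rho> \<omega> < \<top>" using assms(3,4) by (meson le_less_trans top_greatest less_le_trans)
  then have u: "drawdown_time X \<rho> \<omega> = ennreal u" "0 \<le> u" by (simp_all add: u_def)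
  obtain y where y: "run_max X u \<omega> = ereal y" "drawdown_max X \<rho> \<omega> = y"
    using drawdown_time_state[OF assms(1,2) u] by metis
  show ?thesis
  proof
    assume "\<exists>q\<in>\<rat> \<inter> {q. 0 \<le> q \<and> ennreal q < s}. drawdown_time X \<rho> \<omega> < ennreal q \<and> run_max X q \<omega> < ereal c"
    then obtain q where q: "ennreal u < ennreal q" "run_max X q \<omega> < ereal c" unfolding u(1) by auto
    then have "u < q" using u(2) by (simp add: ennreal_less_iff)
    then have "run_max X u \<omega> \<le> run_max X q \<omega>" unfolding run_max_def by (intro SUP_subset_mono) auto
    then have "ereal y < ereal c" using q(2) y(1) by (metis le_less_trans)
    then show "drawdown_max X \<rho> \<omega> < c" using y(2) by simp
  next
    assume "drawdown_max X \<rho> \<omega> < c"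
    then have lt: "run_max X u \<omega> < ereal c" using y by simp
    then have "X u \<omega> < ereal c" using run_max_ge[OF u(2) order_refl, of \<omega>] by auto
    then obtain e where e: "e > 0" "\<And>r. 0 \<le> r \<Longrightarrow> \<bar>r - u\<bar> < e \<Longrightarrow> X r \<omega> \<in> {..<ereal c}"
      using X_near_open[OF assms(1) u(2), of "{..<ereal c}"] by auto
    have "ennreal u < s" using assms(3,4) u by simp
    then obtain b :: rat where b: "ennreal u < ennreal (real_of_rat b)" "ennreal (real_of_rat b) < s"
      using ennreal_rat_dense by blast
    then have ub: "u < real_of_rat b" using u(2) by (simp add: ennreal_less_iff)
    obtain q where q: "q \<in> \<rat>" "u < q" "q < u + min e (real_of_rat b - u)"
      using rational_near[of "min e (real_of_rat b - u)" u] e(1) ub by auto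
    have q0: "0 \<le> q" using q(2) u(2) by simp
    obtain r where r: "0 \<le> r" "r \<le> q" "X r \<omega> = run_max X q \<omega>"
      using run_max_attained[OF assms(1) q0] .
    have "X r \<omega> < ereal c"
    proof (cases "r \<le> u")
      case True then show ?thesis using run_max_ge[OF r(1) True, of \<omega>] lt by simp
    next
      case False then show ?thesis using e(2)[OF r(1)] r(2) q(3) by auto
    qed
    moreover have "ennreal q < s"
      using q(3) b(2) by (intro le_less_trans[OF ennreal_leI b(2)]) auto
    ultimately show "\<exists>q\<in>\<rat> \<inter> {q. 0 \<le> q \<and> ennreal q < s}. drawdown_time X \<rho> \<omega> < ennreal q \<and> run_max X q \<omega> < ereal c"
      using q q0 r(3) u by (intro bexI[of _ q]) (auto simp: ennreal_less_iff)
  qed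
qed

lemma measurable_stopped_sigma_drawdown_max:
  assumes "0 \<le> \<rho>"
  shows "drawdown_max X \<rho> \<in> borel_measurable (stopped_sigma M X (drawdown_time X \<rho>))"
proof -
  have "Measurable.pred (stopped_sigma M X (drawdown_time X \<rho>)) (\<lambda>\<omega>. drawdown_max X \<rho> \<omega> < c)" for c
    unfolding stopped_sigma_def
  proof (rule filtration.pred_pre_sigmaI[OF filtration_right_filtration stopping_time_drawdown_time], rule pred_right_filtrationI)
    fix t s :: ennreal assume ts: "t < s \<or> t = \<top> \<and> s = \<top>"
    show "Measurable.pred (natural_filtration M X s) (\<lambda>\<omega>. drawdown_max X \<rho> \<omega> < c \<and> drawdown_time X \<rho> \<omega> \<le> t)"
    proof (cases "t = \<top>")
      case True
      then have s: "s = \<top>" using ts by auto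
      have [measurable]: "drawdown_max X \<rho> \<in> borel_measurable (natural_filtration M X \<top>)"
        by (rule path_process.measurable_drawdown_max[OF path_process_natural_filtration])
      show ?thesis unfolding True s by simp
    next
      case False
      then have ts: "t < s" using ts by auto
      let ?N = "natural_filtration M X s"
      have 1: "Measurable.pred ?N (\<lambda>\<omega>. drawdown_time X \<rho> \<omega> \<le> t)"
        using stopping_timeD[OF stopping_time_drawdown_time, where t=t] ts
        by (auto simp: pred_def sets_right_filtration space_right_filtration space_natural_filtration)
      have 2: "Measurable.pred ?N (\<lambda>\<omega>. \<exists>q\<in>\<rat> \<inter> {q. 0 \<le> q \<and> ennreal q < s}. drawdown_time X \<rho> \<omega> < ennreal q \<and> run_max X q \<omega> < ereal c)"
      proof (intro measurable_pred_countable countable_Int1 countable_rat pred_intros_logic)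
        fix q assume q: "q \<in> \<rat> \<inter> {q. 0 \<le> q \<and> ennreal q < s}"
        show "Measurable.pred ?N (\<lambda>\<omega>. drawdown_time X \<rho> \<omega> < ennreal q)"
        proof (rule drawdown_time_less_pred[OF space_natural_filtration])
          fix r :: real assume "0 \<le> r" "ennreal r < ennreal q"
          then show "X r \<in> borel_measurable ?N"
            using q by (intro measurable_natural_filtration) auto
        qed
        have [measurable]: "run_max X q \<in> borel_measurable ?N"
          using q by (intro measurable_run_max_min measurable_natural_filtration space_natural_filtration)
            (auto intro: order_trans[OF ennreal_leI less_imp_le])
        show "Measurable.pred ?N (\<lambda>\<omega>. run_max X q \<omega> < ereal c)" by measurable
      qed
      show ?thesis
        by (subst measurable_cong[where g="\<lambda>\<omega>. (\<exists>q\<in>\<rat> \<inter> {q. 0 \<le> q \<and> ennreal q < s}. drawdown_time X \<rho> \<omega> < ennreal q \<and> run_max X q \<omega> < ereal c) \<and> drawdown_time X \<rho> \<omega> \<le> t"])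
           (use drawdown_max_less_iff[OF _ assms _ ts] 1 2 in \<open>auto simp: space_natural_filtration intro: pred_intros_logic\<close>)
    qed
  qed
  then show ?thesis by (intro borel_measurableI_less) (simp add: pred_def)
qed

end

section \<open>The strong Markov property for functionals of past and future\<close>

lemma sets_restrict_space_Int_space:
  assumes "B \<in> sets (restrict_space N G)"
  obtains B' where "B' \<in> sets N" "B = B' \<inter> space (restrict_space N G)"
proof -
  from assms obtain B' where B': "B' \<in> sets N" "B = G \<inter> B'" by (auto simp: sets_restrict_space)
  then have "B = B' \<inter> space (restrict_space N G)"
    using sets.sets_into_space[OF B'(1)] by (auto simp: space_restrict_space)
  with B'(1) show thesis by (rule that)
qed

sublocale regular_diffusion \<subseteq> path: path_process M X
  by unfold_locales (use measurable_X continuous_X not_minf absorbed in auto)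

context regular_diffusion
begin

lemma sets_P: "sets (P x) = sets M"
  and prob_space_P: "prob_space (P x)"
  using measurable_space[OF kernel, of x] by (auto simp: space_prob_algebra)

lemma space_P: "space (P x) = space M"
  by (rule sets_eq_imp_space_eq[OF sets_P])

lemma measurable_P: "f \<in> measurable (P x) N \<longleftrightarrow> f \<in> measurable M N"
  by (rule arg_cong[where f="\<lambda>A. f \<in> A"], rule measurable_cong_sets[OF sets_P refl])

definition law :: "real \<Rightarrow> (real \<Rightarrow> ereal) measure" where
  "law x = distr (P x) path_space (path_from X 0)"

lemma space_law: "space (law x) = space path_space"
  by (simp add: law_def)

lemma measurable_law: "law \<in> borel \<rightarrow>\<^sub>M subprob_algebra path_space"
  unfolding law_def[abs_def]
  by (rule measurable_prob_algebraD, rule measurable_compose[OF kernel])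
     (rule measurable_distr_prob_space[OF path.measurable_path_from_0])

lemma nn_integral_law:
  assumes "g \<in> borel_measurable path_space"
  shows "(\<integral>\<^sup>+w. g w \<partial>law x) = (\<integral>\<^sup>+\<omega>. g (path_from X 0 \<omega>) \<partial>P x)"
  unfolding law_def using assms path.measurable_path_from_0
  by (intro nn_integral_distr) (auto simp: measurable_P)

definition alive_at :: "('w \<Rightarrow> ennreal) \<Rightarrow> 'w set" where
  "alive_at T = {\<omega>\<in>space M. T \<omega> < \<infinity> \<and> X (enn2real (T \<omega>)) \<omega> < \<infinity>}"

lemma measurable_X_at:
  assumes "T \<in> borel_measurable M"
  shows "(\<lambda>\<omega>. X (enn2real (T \<omega>)) \<omega>) \<in> borel_measurable M"
  using measurable_compose[OF _ path.joint_measurable_X, of "\<lambda>\<omega>. (enn2real (T \<omega>), \<omega>)" M] assms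
  by simp

lemma measurable_stopping_time_M:
  assumes "stopping_time (right_filtration M X) T"
  shows "T \<in> borel_measurable M"
  by (rule measurable_from_subalg[OF _ path.measurable_stopped_sigma_time[OF assms]])
     (use path.sets_stopped_sigma_subset[OF assms] in \<open>auto simp: subalgebra_def path.space_stopped_sigma\<close>)

lemma measurable_id_stopped_sigma:
  assumes "stopping_time (right_filtration M X) T"
  shows "(\<lambda>\<omega>. \<omega>) \<in> M \<rightarrow>\<^sub>M stopped_sigma M X T"
  by (rule measurable_from_subalg[of _ "stopped_sigma M X T"])
     (use path.sets_stopped_sigma_subset[OF assms] in \<open>auto simp: subalgebra_def path.space_stopped_sigma\<close>)

lemma sets_alive_at:
  assumes "T \<in> borel_measurable M"
  shows "alive_at T \<in> sets M"
proof -
  note [measurable] = assms measurable_X_at[OF assms]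
  show ?thesis unfolding alive_at_def by measurable
qed

text \<open>The strong Markov property of the diffusion is a statement about rectangles: an event before \<open>T\<close> and
an event for the path after \<open>T\<close>. Both sides of the equation are integrals of \<open>g\<close> over finite measures on
the product of \<open>\<F>\<^sub>T\<close> and path space, and rectangles determine such measures. Functionals \<open>g\<close> that depend
on the past are needed because the corridor at a drawdown time is random.\<close>
lemma strong_Markov_integral:
  assumes T: "stopping_time (right_filtration M X) T"
    and g: "(\<lambda>(\<omega>, w). g \<omega> w) \<in> borel_measurable (stopped_sigma M X T \<Otimes>\<^sub>M path_space)"
  shows "(\<integral>\<^sup>+\<omega>. indicator (alive_at T) \<omega> * g \<omega> (path_from X (enn2real (T \<omega>)) \<omega>) \<partial>P x) =
    (\<integral>\<^sup>+\<omega>. indicator (alive_at T) \<omega> * (\<integral>\<^sup>+w. g \<omega> w \<partial>law (real_of_ereal (X (enn2real (T \<omega>)) \<omega>))) \<partial>P x)"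
proof -
  let ?F = "stopped_sigma M X T" and ?path = "\<lambda>\<omega>. path_from X (enn2real (T \<omega>)) \<omega>"
  let ?law = "\<lambda>\<omega>. law (real_of_ereal (X (enn2real (T \<omega>)) \<omega>))"
  let ?R = "?F \<Otimes>\<^sub>M path_space"
  define N where "N = density (P x) (indicator (alive_at T))"
  interpret prob_space "P x" by (rule prob_space_P)
  have T_M [measurable]: "T \<in> borel_measurable M" by (rule measurable_stopping_time_M[OF T])
  have alive [measurable]: "alive_at T \<in> sets M" by (rule sets_alive_at[OF T_M])
  have [measurable]: "(\<lambda>\<omega>. X (enn2real (T \<omega>)) \<omega>) \<in> borel_measurable M" by (rule measurable_X_at[OF T_M])
  have path [measurable]: "?path \<in> M \<rightarrow>\<^sub>M path_space" by (rule path.measurable_path_from[OF T_M])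
  have id [measurable]: "(\<lambda>\<omega>. \<omega>) \<in> M \<rightarrow>\<^sub>M ?F" by (rule measurable_id_stopped_sigma[OF T])
  have law_m [measurable]: "?law \<in> M \<rightarrow>\<^sub>M subprob_algebra path_space"
    by (rule measurable_compose[OF _ measurable_law]) measurable
  have N_sets: "sets N = sets M" by (simp add: N_def sets_P)
  have N_space: "space N = space M" by (simp add: N_def space_P)
  have N_cong: "f \<in> measurable N L \<longleftrightarrow> f \<in> measurable M L" for f and L :: "'c measure"
    by (rule arg_cong[where f="\<lambda>A. f \<in> A"], rule measurable_cong_sets[OF N_sets refl])
  have N_int: "(\<integral>\<^sup>+\<omega>. h \<omega> \<partial>N) = (\<integral>\<^sup>+\<omega>. indicator (alive_at T) \<omega> * h \<omega> \<partial>P x)"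
    if "h \<in> borel_measurable M" for h
    unfolding N_def using that alive by (intro nn_integral_density) (auto simp: measurable_P)
  define K where "K \<omega> = distr (?law \<omega>) ?R (\<lambda>w. (\<omega>, w))" for \<omega>
  have K: "K \<in> N \<rightarrow>\<^sub>M subprob_algebra ?R"
    unfolding K_def[abs_def] N_cong
  proof (rule measurable_distr2[OF _ law_m])
    show "(\<lambda>(\<omega>, w). (\<omega>, w)) \<in> M \<Otimes>\<^sub>M path_space \<rightarrow>\<^sub>M ?R"
      using measurable_Pair[OF measurable_compose[OF measurable_fst id] measurable_snd]
      by (simp add: split_beta')
  qed
  have graph [measurable]: "(\<lambda>\<omega>. (\<omega>, ?path \<omega>)) \<in> N \<rightarrow>\<^sub>M ?R"
    unfolding N_cong by (intro measurable_Pair id path)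
  have pair: "Pair \<omega> \<in> ?law \<omega> \<rightarrow>\<^sub>M ?R" if "\<omega> \<in> space M" for \<omega>
    using measurable_Pair1'[of \<omega> ?F path_space] that
    by (simp add: path.space_stopped_sigma law_def)
  have ne: "space M \<noteq> {}" using not_empty by (simp add: space_P)
  \<comment> \<open>On the left the joint law of past and future, on the right the past with a future drawn afresh from the state at \<open>T\<close>.\<close>
  have "distr N ?R (\<lambda>\<omega>. (\<omega>, ?path \<omega>)) = N \<bind> K"
  proof (rule measure_eqI_generator_eq)
    let ?E = "{A \<times> B |A B. A \<in> sets ?F \<and> B \<in> sets path_space}"
    let ?\<Omega> = "space ?F \<times> space path_space"
    show "Int_stable ?E" by (rule Int_stable_pair_measure_generator)
    show "?E \<subseteq> Pow ?\<Omega>" by (rule pair_measure_closed)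
    show "sets (distr N ?R (\<lambda>\<omega>. (\<omega>, ?path \<omega>))) = sigma_sets ?\<Omega> ?E" by (simp only: sets_distr sets_pair_measure)
    show "sets (N \<bind> K) = sigma_sets ?\<Omega> ?E"
      by (subst sets_bind[OF sets_kernel[OF K]]) (simp_all add: N_space ne sets_pair_measure)
    show "range (\<lambda>_::nat. ?\<Omega>) \<subseteq> ?E" by auto
    show "(\<Union>i::nat. ?\<Omega>) = ?\<Omega>" by simp
    show "emeasure (distr N ?R (\<lambda>\<omega>. (\<omega>, ?path \<omega>))) ?\<Omega> \<noteq> \<infinity>" for i :: nat
    proof -
      have "emeasure (distr N ?R (\<lambda>\<omega>. (\<omega>, ?path \<omega>))) ?\<Omega> \<le> emeasure N (space N)"
        by (subst emeasure_distr[OF graph]) (auto intro!: emeasure_mono)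
      also have "\<dots> = (\<integral>\<^sup>+\<omega>. indicator (alive_at T) \<omega> \<partial>P x)"
        using N_int[of "\<lambda>_. 1"] by simp
      also have "\<dots> \<le> 1" using alive by (simp add: sets_P measure_le_1 emeasure_le_1)
      finally show ?thesis by (auto simp: top_unique)
    qed
    fix C assume "C \<in> ?E"
    then obtain A B where C: "C = A \<times> B" and A: "A \<in> sets ?F" and B: "B \<in> sets path_space" by auto
    have AM: "A \<in> sets M" using A path.sets_stopped_sigma_subset[OF T] by auto
    from B obtain B' where B': "B' \<in> sets (PiM {0..} (\<lambda>_. borel))" and BB: "B = B' \<inter> space path_space"
      unfolding path_space_def by (rule sets_restrict_space_Int_space)
    have in_B: "path_from X u \<omega> \<in> B \<longleftrightarrow> path_from X u \<omega> \<in> B'" if "\<omega> \<in> space M" "0 \<le> u" for u \<omega>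
      using path.path_from_in_path_space[OF that] BB by auto
    have law_B: "emeasure (law z) B = emeasure (P z) {\<omega>\<in>space M. path_from X 0 \<omega> \<in> B'}" for z
      unfolding law_def using B path.measurable_path_from_0 in_B
      by (subst emeasure_distr) (auto simp: measurable_P space_P intro!: arg_cong[where f="emeasure (P z)"])
    have S: "{\<omega>\<in>A \<inter> alive_at T. ?path \<omega> \<in> B'} = A \<inter> alive_at T \<inter> (?path -` B \<inter> space M)"
      using in_B by (auto simp: alive_at_def)
    have "emeasure (distr N ?R (\<lambda>\<omega>. (\<omega>, ?path \<omega>))) C = emeasure N (A \<inter> (?path -` B \<inter> space M))"
      unfolding C using A B sets.sets_into_space[OF AM]
      by (subst emeasure_distr[OF graph]) (auto simp: N_space intro!: arg_cong[where f="emeasure N"])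
    also have "\<dots> = (\<integral>\<^sup>+\<omega>. indicator (alive_at T) \<omega> * indicator (A \<inter> (?path -` B \<inter> space M)) \<omega> \<partial>P x)"
      unfolding N_def using AM alive measurable_sets[OF path B]
      by (intro emeasure_density) (auto simp: sets_P measurable_P)
    also have "\<dots> = (\<integral>\<^sup>+\<omega>. indicator {\<omega>\<in>A \<inter> alive_at T. ?path \<omega> \<in> B'} \<omega> \<partial>P x)"
      unfolding S by (intro nn_integral_cong) (auto split: split_indicator)
    also have "\<dots> = emeasure (P x) {\<omega>\<in>A \<inter> alive_at T. ?path \<omega> \<in> B'}"
      unfolding S using AM alive measurable_sets[OF path B] by (intro nn_integral_indicator) (auto simp: sets_P)
    also have "\<dots> = (\<integral>\<^sup>+\<omega>\<in>A \<inter> alive_at T. emeasure (?law \<omega>) B \<partial>P x)"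
      unfolding law_B by (rule strong_Markov[OF T A B' alive_at_def])
    also have "\<dots> = (\<integral>\<^sup>+\<omega>. indicator (alive_at T) \<omega> * (indicator A \<omega> * emeasure (?law \<omega>) B) \<partial>P x)"
      by (intro nn_integral_cong) (auto split: split_indicator)
    also have "\<dots> = (\<integral>\<^sup>+\<omega>. indicator A \<omega> * emeasure (?law \<omega>) B \<partial>N)"
      using AM B by (intro N_int[symmetric]) (auto intro!: borel_measurable_times measurable_emeasure_kernel[OF law_m])
    also have "\<dots> = (\<integral>\<^sup>+\<omega>. emeasure (K \<omega>) C \<partial>N)"
    proof (rule nn_integral_cong)
      fix \<omega> assume "\<omega> \<in> space N"
      then have w: "\<omega> \<in> space M" by (simp add: N_space)
      show "indicator A \<omega> * emeasure (?law \<omega>) B = emeasure (K \<omega>) C"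
        unfolding K_def C using A B
        by (subst emeasure_distr[OF pair[OF w]])
           (auto simp: space_law split: split_indicator dest: sets.sets_into_space intro!: arg_cong[where f="emeasure (?law \<omega>)"])
    qed
    also have "\<dots> = emeasure (N \<bind> K) C"
      using A B C ne N_space by (intro emeasure_bind[symmetric, OF _ K]) auto
    finally show "emeasure (distr N ?R (\<lambda>\<omega>. (\<omega>, ?path \<omega>))) C = emeasure (N \<bind> K) C" .
  qed
  then have "(\<integral>\<^sup>+p. (case p of (\<omega>, w) \<Rightarrow> g \<omega> w) \<partial>distr N ?R (\<lambda>\<omega>. (\<omega>, ?path \<omega>))) =
      (\<integral>\<^sup>+p. (case p of (\<omega>, w) \<Rightarrow> g \<omega> w) \<partial>(N \<bind> K))" by simp
  moreover have "(\<integral>\<^sup>+p. (case p of (\<omega>, w) \<Rightarrow> g \<omega> w) \<partial>distr N ?R (\<lambda>\<omega>. (\<omega>, ?path \<omega>))) =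
      (\<integral>\<^sup>+\<omega>. indicator (alive_at T) \<omega> * g \<omega> (?path \<omega>) \<partial>P x)"
    using measurable_compose[OF graph g] g
    by (subst nn_integral_distr[OF graph]) (simp_all add: N_int N_cong)
  moreover have "(\<integral>\<^sup>+p. (case p of (\<omega>, w) \<Rightarrow> g \<omega> w) \<partial>(N \<bind> K)) =
      (\<integral>\<^sup>+\<omega>. (\<integral>\<^sup>+w. g \<omega> w \<partial>?law \<omega>) \<partial>N)"
    unfolding nn_integral_bind[OF g K]
  proof (rule nn_integral_cong)
    fix \<omega> assume "\<omega> \<in> space N"
    then have p: "Pair \<omega> \<in> ?law \<omega> \<rightarrow>\<^sub>M ?R" by (intro pair) (simp add: N_space)
    show "(\<integral>\<^sup>+p. (case p of (\<omega>, w) \<Rightarrow> g \<omega> w) \<partial>K \<omega>) = (\<integral>\<^sup>+w. g \<omega> w \<partial>?law \<omega>)"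
      unfolding K_def nn_integral_distr[OF p, unfolded measurable_distr_eq1, OF g] by simp
  qed
  moreover have "(\<lambda>\<omega>. \<integral>\<^sup>+w. g \<omega> w \<partial>?law \<omega>) \<in> borel_measurable M"
  proof (rule nn_integral_measurable_subprob_algebra2[OF _ law_m])
    show "(\<lambda>(\<omega>, w). g \<omega> w) \<in> borel_measurable (M \<Otimes>\<^sub>M path_space)"
      using measurable_compose[OF measurable_Pair[OF measurable_compose[OF measurable_fst id] measurable_snd] g]
      by (simp add: split_beta')
  qed
  ultimately show ?thesis by (simp add: N_int)
qed

lemma AE_in_space: "AE \<omega> in P x. \<omega> \<in> space M"
  using AE_space[of "P x"] by (simp add: space_P)

lemma strong_Markov_AE:
  assumes T: "stopping_time (right_filtration M X) T"
    and p: "Measurable.pred (stopped_sigma M X T \<Otimes>\<^sub>M path_space) (\<lambda>(\<omega>, w). p \<omega> w)"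
    and ae: "\<And>\<omega>. \<omega> \<in> alive_at T \<Longrightarrow> AE w in law (real_of_ereal (X (enn2real (T \<omega>)) \<omega>)). p \<omega> w"
  shows "AE \<omega> in P x. \<omega> \<in> alive_at T \<longrightarrow> p \<omega> (path_from X (enn2real (T \<omega>)) \<omega>)"
proof -
  let ?path = "\<lambda>\<omega>. path_from X (enn2real (T \<omega>)) \<omega>"
  let ?g = "\<lambda>\<omega> w. indicator {q. \<not> (case q of (\<omega>, w) \<Rightarrow> p \<omega> w)} (\<omega>, w) :: ennreal"
  note [measurable] = p
  have T_M: "T \<in> borel_measurable M" by (rule measurable_stopping_time_M[OF T])
  have alive [measurable]: "alive_at T \<in> sets M" by (rule sets_alive_at[OF T_M])
  have g: "(\<lambda>(\<omega>, w). ?g \<omega> w) \<in> borel_measurable (stopped_sigma M X T \<Otimes>\<^sub>M path_space)"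
    unfolding split_beta' prod.collapse by measurable
  have graph: "(\<lambda>\<omega>. (\<omega>, ?path \<omega>)) \<in> M \<rightarrow>\<^sub>M stopped_sigma M X T \<Otimes>\<^sub>M path_space"
    by (intro measurable_Pair measurable_id_stopped_sigma[OF T] path.measurable_path_from[OF T_M])
  have gm: "(\<lambda>\<omega>. ?g \<omega> (?path \<omega>)) \<in> borel_measurable M"
    using measurable_compose[OF graph g] by simp
  have "(\<integral>\<^sup>+\<omega>. indicator (alive_at T) \<omega> * ?g \<omega> (?path \<omega>) \<partial>P x) =
    (\<integral>\<^sup>+\<omega>. indicator (alive_at T) \<omega> * (\<integral>\<^sup>+w. ?g \<omega> w \<partial>law (real_of_ereal (X (enn2real (T \<omega>)) \<omega>))) \<partial>P x)"
    by (rule strong_Markov_integral[OF T g])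
  also have "\<dots> = (\<integral>\<^sup>+\<omega>. 0 \<partial>P x)"
  proof (rule nn_integral_cong)
    fix \<omega>
    show "indicator (alive_at T) \<omega> * (\<integral>\<^sup>+w. ?g \<omega> w \<partial>law (real_of_ereal (X (enn2real (T \<omega>)) \<omega>))) = 0"
    proof (cases "\<omega> \<in> alive_at T")
      case True
      have "(\<integral>\<^sup>+w. ?g \<omega> w \<partial>law (real_of_ereal (X (enn2real (T \<omega>)) \<omega>))) =
          (\<integral>\<^sup>+w. 0 \<partial>law (real_of_ereal (X (enn2real (T \<omega>)) \<omega>)))"
        using ae[OF True] by (intro nn_integral_cong_AE) (auto simp: indicator_def)
      then show ?thesis by simp
    qed simp
  qed
  finally have "(\<integral>\<^sup>+\<omega>. indicator (alive_at T) \<omega> * ?g \<omega> (?path \<omega>) \<partial>P x) = 0" by simp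
  then have "AE \<omega> in P x. indicator (alive_at T) \<omega> * ?g \<omega> (?path \<omega>) = 0"
    using gm alive by (subst (asm) nn_integral_0_iff_AE) (auto simp: measurable_P)
  then show ?thesis by eventually_elim (auto simp: indicator_def split: if_splits)
qed

end

section \<open>Immediate crossing of levels\<close>

context path_process
begin

lemma hit_compose_measurable:
  assumes "h \<in> borel_measurable N" "k \<in> N \<rightarrow>\<^sub>M M"
  shows "(\<lambda>q. hit X (h q) (k q)) \<in> borel_measurable N"
  using measurable_compose[OF measurable_Pair[OF assms] joint_measurable_hit] by simp

lemma path_from_compose_measurable:
  assumes "h \<in> borel_measurable N" "k \<in> N \<rightarrow>\<^sub>M M"
  shows "(\<lambda>q. path_from X (enn2real (h q)) (k q)) \<in> N \<rightarrow>\<^sub>M path_space"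
proof -
  have "(\<lambda>q. enn2real (h q)) \<in> borel_measurable N" using assms(1) by measurable
  from measurable_compose[OF measurable_Pair[OF this assms(2)] joint_measurable_path_from]
  show ?thesis by simp
qed

end

lemma crosses_down_iff_rat:
  assumes "v \<in> space path_space"
  shows "crosses_down v z \<longleftrightarrow> (\<forall>n::nat. \<exists>q\<in>\<rat> \<inter> {0..<1 / real (Suc n)}. v q < ereal z)"
proof
  assume c: "crosses_down v z"
  show "\<forall>n::nat. \<exists>q\<in>\<rat> \<inter> {0..<1 / real (Suc n)}. v q < ereal z"
  proof
    fix n :: nat
    obtain r where r: "0 \<le> r" "r < 1 / real (Suc n)" "v r < ereal z"
      using c[unfolded crosses_down_def, rule_format, of "1 / real (Suc n)"] by auto
    obtain e where e: "e > 0" "\<And>q. 0 \<le> q \<Longrightarrow> \<bar>q - r\<bar> < e \<Longrightarrow> v q \<in> {..<ereal z}"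
      using W.X_near_open[OF assms r(1), of "{..<ereal z}"] r(3) by auto
    obtain q where "q \<in> \<rat>" "r < q" "q < r + min e (1 / real (Suc n) - r)"
      using rational_near[of "min e (1 / real (Suc n) - r)" r] e(1) r(2) by auto
    then show "\<exists>q\<in>\<rat> \<inter> {0..<1 / real (Suc n)}. v q < ereal z"
      using r(1) e(2)[of q] by (intro bexI[of _ q]) auto
  qed
next
  assume *: "\<forall>n::nat. \<exists>q\<in>\<rat> \<inter> {0..<1 / real (Suc n)}. v q < ereal z"
  show "crosses_down v z"
    unfolding crosses_down_def
  proof (intro allI impI)
    fix e :: real assume "e > 0"
    then obtain n :: nat where n: "1 / real (Suc n) < e" using nat_approx_posE by blast
    obtain q where "q \<in> \<rat> \<inter> {0..<1 / real (Suc n)}" "v q < ereal z" using * by blast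
    with n show "\<exists>r\<ge>0. r < e \<and> v r < ereal z" by (intro exI[of _ q]) auto
  qed
qed

lemma pred_crosses_down:
  fixes h :: "'b \<Rightarrow> real"
  assumes [measurable]: "h \<in> borel_measurable N" and k: "k \<in> N \<rightarrow>\<^sub>M path_space"
  shows "Measurable.pred N (\<lambda>q. crosses_down (k q) (h q))"
proof -
  have "Measurable.pred N (\<lambda>p. \<forall>n::nat. \<exists>q\<in>\<rat> \<inter> {0..<1 / real (Suc n)}. k p q < ereal (h p))"
  proof (intro pred_intros_countable measurable_pred_countable countable_Int1 countable_rat)
    fix n :: nat and q :: real assume "q \<in> \<rat> \<inter> {0..<1 / real (Suc n)}"
    then have [measurable]: "(\<lambda>p. k p q) \<in> borel_measurable N"
      by (intro measurable_compose[OF k W.measurable_X]) auto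
    show "Measurable.pred N (\<lambda>p. k p q < ereal (h p))" by measurable
  qed
  then show ?thesis
    by (subst measurable_cong[OF crosses_down_iff_rat]) (use measurable_space[OF k] in auto)
qed

context regular_diffusion
begin

text \<open>The probability of hitting \<open>a k\<close> before \<open>b\<close> tends to \<open>1\<close> since the scale function is continuous at \<open>z\<close>.\<close>
lemma AE_hit_below_first:
  assumes S: "scale_function P X S" and zb: "z < b" and a: "a \<longlonglongrightarrow> z" "\<And>k. a k < z"
  shows "AE \<omega> in P z. \<exists>k::nat. hit X (a k) \<omega> < hit X b \<omega>"
proof -
  interpret prob_space "P z" by (rule prob_space_P)
  have [measurable]: "hit X y \<in> borel_measurable (P z)" for y
    using path.measurable_hit by (simp add: measurable_P)
  let ?E = "{\<omega>\<in>space (P z). \<exists>k::nat. hit X (a k) \<omega> < hit X b \<omega>}"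
  have mono: "strict_mono S" and cont: "continuous_on UNIV S"
    and exit: "\<And>a x b. a < x \<Longrightarrow> x < b \<Longrightarrow>
      measure (P x) {\<omega>\<in>space (P x). hit X a \<omega> < hit X b \<omega>} = (S b - S x) / (S b - S a)"
    using S by (auto simp: scale_function_def)
  have "S z < S b" using mono zb by (simp add: strict_monoD)
  have "(\<lambda>k. S (a k)) \<longlonglongrightarrow> S z"
    by (rule continuous_on_tendsto_compose[OF cont a(1)]) auto
  then have "(\<lambda>k. (S b - S z) / (S b - S (a k))) \<longlonglongrightarrow> (S b - S z) / (S b - S z)"
    using \<open>S z < S b\<close> by (intro tendsto_intros) auto
  then have lim: "(\<lambda>k. (S b - S z) / (S b - S (a k))) \<longlonglongrightarrow> 1"
    using \<open>S z < S b\<close> by simp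
  have "(S b - S z) / (S b - S (a k)) \<le> prob ?E" for k
    unfolding exit[OF a(2) zb, symmetric] by (rule finite_measure_mono) auto
  then have "1 \<le> prob ?E" by (intro LIMSEQ_le_const2[OF lim]) auto
  then have "prob ?E = 1" using prob_le_1 by (simp add: antisym)
  moreover have "?E \<in> events" by measurable
  ultimately show ?thesis using prob_eq_1[of ?E] by auto
qed

text \<open>The Green function of an interval is bounded by its length in scale, so the mean exit time is at most
this length times the speed measure of the interval. The first factor tends to \<open>0\<close>; the second one
is bounded because the density is locally bounded.\<close>
lemma AE_exit_immediately:
  assumes S: "scale_function P X S" and m: "speed_measure P X S m"
    and d: "continuous_on UNIV d" "m = density lborel (\<lambda>x. ennreal (d x))"
    and a: "a \<longlonglongrightarrow> z" "\<And>k. a k < z" "\<And>k. z - 1 \<le> a k"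
    and b: "b \<longlonglongrightarrow> z" "\<And>k. z < b k" "\<And>k. b k \<le> z + 1"
  shows "AE \<omega> in P z. (INF k::nat. min (hit X (a k) \<omega>) (hit X (b k) \<omega>)) = 0"
proof -
  have [measurable]: "hit X y \<in> borel_measurable (P z)" for y
    using path.measurable_hit by (simp add: measurable_P)
  have mono: "strict_mono S" and cont: "continuous_on UNIV S"
    using S by (auto simp: scale_function_def)
  have dm [measurable]: "d \<in> borel_measurable borel" using d(1) by (rule borel_measurable_continuous_onI)
  obtain C where C: "\<And>x. x \<in> {z - 1..z + 1} \<Longrightarrow> d x \<le> C"
  proof -
    have "\<exists>x\<in>{z - 1..z + 1}. \<forall>y\<in>{z - 1..z + 1}. d y \<le> d x"
      using d(1) by (intro continuous_attains_sup) (auto intro: continuous_on_subset)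
    then show thesis using that by blast
  qed
  define c where "c = emeasure m {z - 1..z + 1}"
  have "c = (\<integral>\<^sup>+x. ennreal (d x) * indicator {z - 1..z + 1} x \<partial>lborel)"
    unfolding c_def d(2) by (intro emeasure_density) auto
  also have "\<dots> \<le> (\<integral>\<^sup>+x. ennreal C * indicator {z - 1..z + 1} x \<partial>lborel)"
    using C by (intro nn_integral_mono) (auto split: split_indicator intro!: ennreal_leI)
  also have "\<dots> = ennreal C * 2"
    by (subst nn_integral_cmult_indicator) (auto simp: emeasure_lborel_Icc_eq)
  also have "\<dots> < \<top>" by (simp add: ennreal_mult_less_top)
  finally have c: "c < \<top>" .
  have sets_m [measurable_cong]: "sets m = sets borel" using d(2) by simp
  have bound: "(\<integral>\<^sup>+\<omega>. min (hit X (a k) \<omega>) (hit X (b k) \<omega>) \<partial>P z) \<le> ennreal (S (b k) - S (a k)) * c" for k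
  proof -
    have Sab: "S (a k) < S (b k)" using mono a(2)[of k] b(2)[of k] by (simp add: strict_monoD)
    have "(\<integral>\<^sup>+\<omega>. min (hit X (a k) \<omega>) (hit X (b k) \<omega>) \<partial>P z) =
      (\<integral>\<^sup>+y\<in>{a k<..<b k}. ennreal ((S (min z y) - S (a k)) * (S (b k) - S (max z y)) / (S (b k) - S (a k))) \<partial>m)"
      using m a(2) b(2) unfolding speed_measure_def by blast
    also have "\<dots> \<le> (\<integral>\<^sup>+y. ennreal (S (b k) - S (a k)) * indicator {z - 1..z + 1} y \<partial>m)"
    proof (rule nn_integral_mono)
      fix y
      show "ennreal ((S (min z y) - S (a k)) * (S (b k) - S (max z y)) / (S (b k) - S (a k))) * indicator {a k<..<b k} y
        \<le> ennreal (S (b k) - S (a k)) * indicator {z - 1..z + 1} y"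
      proof (cases "y \<in> {a k<..<b k}")
        case True
        have le: "S u \<le> S v" if "u \<le> v" for u v using mono that by (simp add: strict_mono_less_eq)
        have "(S (min z y) - S (a k)) * (S (b k) - S (max z y)) \<le> (S (b k) - S (a k)) * (S (b k) - S (a k))"
          using True a(2)[of k] b(2)[of k] by (intro mult_mono diff_mono) (auto intro!: le)
        then have "(S (min z y) - S (a k)) * (S (b k) - S (max z y)) / (S (b k) - S (a k)) \<le> S (b k) - S (a k)"
          using Sab by (simp add: divide_le_eq)
        moreover have "y \<in> {z - 1..z + 1}" using True a(3)[of k] b(3)[of k] by auto
        ultimately show ?thesis using True by (simp add: ennreal_leI)
      qed simp
    qed
    also have "\<dots> = ennreal (S (b k) - S (a k)) * c"
      unfolding c_def by (subst nn_integral_cmult_indicator) (auto simp: sets_m)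
    finally show ?thesis .
  qed
  have "(\<lambda>k. S (b k) - S (a k)) \<longlonglongrightarrow> S z - S z"
    by (intro tendsto_diff continuous_on_tendsto_compose[OF cont] a(1) b(1)) auto
  then have "(\<lambda>k. ennreal (S (b k) - S (a k))) \<longlonglongrightarrow> ennreal 0"
    by (intro tendsto_ennrealI) simp
  then have lim: "(\<lambda>k. ennreal (S (b k) - S (a k)) * c) \<longlonglongrightarrow> 0 * c"
    using c by (intro tendsto_mult_ennreal) auto
  have "(\<integral>\<^sup>+\<omega>. (INF k. min (hit X (a k) \<omega>) (hit X (b k) \<omega>)) \<partial>P z) \<le> ennreal (S (b k) - S (a k)) * c" for k
    by (rule order_trans[OF nn_integral_mono bound]) (rule INF_lower, simp)
  then have "(\<integral>\<^sup>+\<omega>. (INF k. min (hit X (a k) \<omega>) (hit X (b k) \<omega>)) \<partial>P z) \<le> 0 * c"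
    by (intro LIMSEQ_le_const[OF lim]) auto
  then have "(\<integral>\<^sup>+\<omega>. (INF k. min (hit X (a k) \<omega>) (hit X (b k) \<omega>)) \<partial>P z) = 0" by simp
  then show ?thesis by (subst (asm) nn_integral_0_iff_AE) auto
qed

text \<open>Almost surely the path leaves a small interval around \<open>z\<close> before time \<open>e\<close>. If it leaves through the lower
end it is below \<open>z\<close>; if it leaves through the upper end it has been below \<open>z\<close> even earlier.\<close>
lemma AE_law_crosses_down:
  assumes S: "scale_function P X S" and m: "speed_measure P X S m"
    and d: "continuous_on UNIV d" "m = density lborel (\<lambda>x. ennreal (d x))"
  shows "AE w in law z. crosses_down w z"
proof -
  define a b :: "nat \<Rightarrow> real" where "a k = z - 1 / real (Suc k)" and "b k = z + 1 / real (Suc k)" for k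
  have a: "a \<longlonglongrightarrow> z" "\<And>k. a k < z" "\<And>k. z - 1 \<le> a k"
    unfolding a_def[abs_def] using tendsto_diff[OF tendsto_const[of z] lim_inverse_n'[THEN LIMSEQ_Suc]] by auto
  have b: "b \<longlonglongrightarrow> z" "\<And>k. z < b k" "\<And>k. b k \<le> z + 1"
    unfolding b_def[abs_def] using tendsto_add[OF tendsto_const[of z] lim_inverse_n'[THEN LIMSEQ_Suc]] by auto
  have "AE \<omega> in P z. \<forall>n. \<exists>k. hit X (a k) \<omega> < hit X (b n) \<omega>"
    unfolding AE_all_countable using AE_hit_below_first[OF S b(2) a(1,2)] by blast
  moreover have "AE \<omega> in P z. \<omega> \<in> space M" using AE_space[of "P z"] by (simp add: space_P)
  ultimately have "AE \<omega> in P z. crosses_down (path_from X 0 \<omega>) z"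
    using AE_exit_immediately[OF S m d a b]
  proof eventually_elim
    case (elim \<omega>)
    show ?case unfolding crosses_down_def
    proof (intro allI impI)
      fix e :: real assume e: "0 < e"
      have "\<exists>j. hit X (a j) \<omega> < ennreal e"
      proof -
        have "(INF k. min (hit X (a k) \<omega>) (hit X (b k) \<omega>)) < ennreal e" using elim(3) e by simp
        then obtain k where "min (hit X (a k) \<omega>) (hit X (b k) \<omega>) < ennreal e" unfolding INF_less_iff by auto
        moreover obtain j where "hit X (a j) \<omega> < hit X (b k) \<omega>" using elim(1) by auto
        ultimately show ?thesis by (auto simp: min_less_iff_disj intro: less_trans)
      qed
      then obtain j where j: "hit X (a j) \<omega> < ennreal e" by auto
      then have fin: "hit X (a j) \<omega> < \<infinity>" using less_le_trans[OF j top_greatest] by simp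
      let ?r = "enn2real (hit X (a j) \<omega>)"
      have "ennreal ?r < ennreal e" using j fin by simp
      then have "?r < e" by (simp add: ennreal_less_iff)
      moreover have "X ?r \<omega> < ereal z" using path.X_hit[OF elim(2) fin] a(2)[of j] by simp
      ultimately show "\<exists>r\<ge>0. r < e \<and> path_from X 0 \<omega> r < ereal z"
        by (intro exI[of _ ?r]) (simp add: path_from_apply)
    qed
  qed
  moreover have "Measurable.pred path_space (\<lambda>w. crosses_down w z)"
    by (rule pred_crosses_down) auto
  ultimately show ?thesis
    unfolding law_def using path.measurable_path_from_0
    by (subst AE_distr_iff) (auto simp: measurable_P pred_def)
qed

lemma AE_law_crosses_down_after_hit:
  assumes cross: "AE w in law z. crosses_down w z"
  shows "AE w in law x. hit coord z w < \<infinity> \<longrightarrow> crosses_down (path_from coord (enn2real (hit coord z w)) w) z"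
proof -
  let ?T = "hit X z"
  have T: "stopping_time (right_filtration M X) ?T" by (rule path.stopping_time_hit)
  have pred [measurable]: "Measurable.pred path_space (\<lambda>w. crosses_down w z)"
    by (rule pred_crosses_down) auto
  have alive: "\<omega> \<in> alive_at ?T \<longleftrightarrow> ?T \<omega> < \<infinity>" if "\<omega> \<in> space M" for \<omega>
    using path.X_hit[OF that, of z] that by (auto simp: alive_at_def)
  have "AE \<omega> in P x. \<omega> \<in> alive_at ?T \<longrightarrow> crosses_down (path_from X (enn2real (?T \<omega>)) \<omega>) z"
  proof (rule strong_Markov_AE[OF T])
    show "Measurable.pred (stopped_sigma M X ?T \<Otimes>\<^sub>M path_space) (\<lambda>(\<omega>, w). crosses_down w z)"
      unfolding split_beta' by (rule measurable_compose[OF measurable_snd pred])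
    show "AE w in law (real_of_ereal (X (enn2real (?T \<omega>)) \<omega>)). crosses_down w z" if "\<omega> \<in> alive_at ?T" for \<omega>
    proof -
      have z: "real_of_ereal (X (enn2real (?T \<omega>)) \<omega>) = z"
        using path.X_hit[of \<omega> z] that by (simp add: alive_at_def)
      show ?thesis unfolding z by (rule cross)
    qed
  qed
  then have "AE \<omega> in P x. hit X z \<omega> < \<infinity> \<longrightarrow> crosses_down (path_from X (enn2real (hit X z \<omega>)) \<omega>) z"
    using AE_in_space by eventually_elim (simp add: alive)
  moreover have "Measurable.pred path_space (\<lambda>w. hit coord z w < \<infinity> \<longrightarrow>
      crosses_down (path_from coord (enn2real (hit coord z w)) w) z)"
  proof -
    have [measurable]: "hit coord z \<in> borel_measurable path_space" by (rule W.measurable_hit)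
    have [measurable]: "Measurable.pred path_space (\<lambda>w. crosses_down (path_from coord (enn2real (hit coord z w)) w) z)"
      by (intro pred_crosses_down W.measurable_path_from) auto
    show ?thesis by measurable
  qed
  ultimately show ?thesis
    unfolding law_def using path.measurable_path_from_0
    by (subst AE_distr_iff) (auto simp: measurable_P pred_def path_functionals_path_from_0 path_from_path_from)
qed

end

section \<open>The drawdown after the next exit from the corridor\<close>

text \<open>The value of \<open>f (M\<^bsub>\<theta>\<^sub>\<delta>\<^esub>, \<theta>\<^sub>\<delta>)\<close> in terms of the pair \<open>p = (y, s)\<close> of maximum and time at an earlier drawdown time
and of the path \<open>w\<close> after it; the summands belong to the two ways of leaving the corridor.\<close>
definition drawdown_payoff :: "(real \<times> real \<Rightarrow> real) \<Rightarrow> real \<Rightarrow> real \<times> real \<Rightarrow> (real \<Rightarrow> ereal) \<Rightarrow> ennreal" where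
  "drawdown_payoff f \<delta> p w =
     (let y = fst p; s = snd p; v = path_from coord (enn2real (hit coord y w)) w in
      indicator {w. hit coord (y - \<delta>) w < hit coord y w} w *
        ennreal (f (y, s + enn2real (hit coord (y - \<delta>) w))) +
      indicator {w. hit coord y w < hit coord (y - \<delta>) w} w *
        ennreal (f (drawdown_max coord \<delta> v, s + enn2real (hit coord y w) + enn2real (drawdown_time coord \<delta> v))))"

lemma measurable_drawdown_payoff:
  assumes f [measurable]: "f \<in> borel_measurable borel" and p: "p \<in> N \<rightarrow>\<^sub>M borel \<Otimes>\<^sub>M borel" and k [measurable]: "k \<in> N \<rightarrow>\<^sub>M path_space"
  shows "(\<lambda>q. drawdown_payoff f \<delta> (p q) (k q)) \<in> borel_measurable N"
proof -
  have f2 [measurable]: "f \<in> borel_measurable (borel \<Otimes>\<^sub>M borel)" using f by (simp add: borel_prod)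
  have [measurable]: "(\<lambda>q. fst (p q)) \<in> borel_measurable N" "(\<lambda>q. snd (p q)) \<in> borel_measurable N"
    using measurable_compose[OF p measurable_fst] measurable_compose[OF p measurable_snd] by auto
  have H1 [measurable]: "(\<lambda>q. hit coord (fst (p q) - \<delta>) (k q)) \<in> borel_measurable N"
    and H2 [measurable]: "(\<lambda>q. hit coord (fst (p q)) (k q)) \<in> borel_measurable N"
    by (rule W.hit_compose_measurable[OF _ k], measurable)+
  have v: "(\<lambda>q. path_from coord (enn2real (hit coord (fst (p q)) (k q))) (k q)) \<in> N \<rightarrow>\<^sub>M path_space"
    by (rule W.path_from_compose_measurable[OF H2 k])
  note [measurable] = measurable_compose[OF v W.measurable_drawdown_max, of \<delta>]
    measurable_compose[OF v W.measurable_drawdown_time, of \<delta>]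
  show ?thesis unfolding drawdown_payoff_def Let_def indicator_def by measurable
qed

context path_process
begin

lemma drawdown_payoff_at_drawdown:
  assumes "\<omega> \<in> space M" "0 \<le> \<rho>" "\<rho> < \<delta>" "drawdown_time X \<rho> \<omega> < \<infinity>" "drawdown_time X \<delta> \<omega> < \<infinity>"
    and w: "w = path_from X (enn2real (drawdown_time X \<rho> \<omega>)) \<omega>" and y: "y = drawdown_max X \<rho> \<omega>"
    and cross: "hit coord (y - \<delta>) w < \<infinity> \<longrightarrow>
      crosses_down (path_from coord (enn2real (hit coord (y - \<delta>) w)) w) (y - \<delta>)"
  shows "ennreal (f (drawdown_max X \<delta> \<omega>, enn2real (drawdown_time X \<delta> \<omega>))) =
    drawdown_payoff f \<delta> (y, enn2real (drawdown_time X \<rho> \<omega>)) w"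
proof -
  define u where "u = enn2real (drawdown_time X \<rho> \<omega>)"
  have u: "drawdown_time X \<rho> \<omega> = ennreal u" "0 \<le> u" using assms(4) by (simp_all add: u_def)
  note w' = w[folded u_def]
  consider (lower) "hit coord (y - \<delta>) w < hit coord y w" | (upper) "hit coord y w < hit coord (y - \<delta>) w"
    using hit_order_after_drawdown[OF assms(1-3) u w' y assms(5)] by blast
  then show ?thesis
  proof cases
    case lower
    have "hit coord (y - \<delta>) w < \<infinity>" using less_le_trans[OF lower top_greatest] by simp
    note d = drawdown_if_lower_first[OF assms(1-3) u w' y lower cross[rule_format, OF this]]
    show ?thesis unfolding d u_def[symmetric] drawdown_payoff_def Let_def
      using lower u(2) by (auto simp del: ennreal_plus)
  next
    case upper
    note d = drawdown_if_upper_first[OF assms(1-3) u w' y upper refl]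
    define v where "v = path_from coord (enn2real (hit coord y w)) w"
    have fin: "drawdown_time coord \<delta> v < \<infinity>" using assms(5) unfolding d(1) v_def by simp
    have "enn2real (drawdown_time X \<delta> \<omega>) = u + enn2real (hit coord y w) + enn2real (drawdown_time coord \<delta> v)"
      unfolding d(1) v_def[symmetric] using fin u(2)
      by (subst enn2real_plus) (auto simp del: ennreal_plus)
    then show ?thesis unfolding d(2)[OF assms(5)] u_def[symmetric] drawdown_payoff_def Let_def
      using upper by (simp add: v_def)
  qed
qed

end

context regular_diffusion
begin

lemma F_dd_eq_law:
  assumes "f \<in> borel_measurable borel"
  shows "F_dd P X f \<delta> y a = (\<integral>\<^sup>+w. ennreal (f (drawdown_max coord \<delta> w, a + enn2real (drawdown_time coord \<delta> w))) \<partial>law y)"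
proof -
  have [measurable]: "f \<in> borel_measurable (borel \<Otimes>\<^sub>M borel)" using assms by (simp add: borel_prod)
  note [measurable] = W.measurable_drawdown_max[of \<delta>] W.measurable_drawdown_time[of \<delta>]
  have "(\<lambda>w. ennreal (f (drawdown_max coord \<delta> w, a + enn2real (drawdown_time coord \<delta> w)))) \<in> borel_measurable path_space"
    by measurable
  from nn_integral_law[OF this] show ?thesis
    by (simp add: F_dd_def path_functionals_path_from_0)
qed

text \<open>Only the second summand of the payoff needs an argument: given the path up to the hitting time of \<open>y\<close>,
the strong Markov property replaces the payoff of the path after it by its mean \<open>F\<^sub>\<delta>\<close>.\<close>
lemma Q_dd_eq_law:
  assumes f: "f \<in> borel_measurable borel"
  shows "Q_dd P X f \<rho> \<delta> y s = (\<integral>\<^sup>+w. drawdown_payoff f \<delta> (y, s) w \<partial>law (y - \<rho>))"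
proof -
  have [measurable]: "f \<in> borel_measurable (borel \<Otimes>\<^sub>M borel)" using f by (simp add: borel_prod)
  let ?T = "hit X y" and ?x = "y - \<rho>"
  let ?L = "{\<omega>. hit X (y - \<delta>) \<omega> < hit X y \<omega>}" and ?U = "{\<omega>. hit X y \<omega> < hit X (y - \<delta>) \<omega>}"
  let ?v = "\<lambda>\<omega>. path_from X (enn2real (hit X y \<omega>)) \<omega>"
  let ?h = "\<lambda>\<omega> w. ennreal (f (drawdown_max coord \<delta> w, s + enn2real (hit X y \<omega>) + enn2real (drawdown_time coord \<delta> w)))"
  have T: "stopping_time (right_filtration M X) ?T" by (rule path.stopping_time_hit)
  note [measurable] = path.measurable_hit W.measurable_drawdown_max[of \<delta>] W.measurable_drawdown_time[of \<delta>]
  have v [measurable]: "?v \<in> M \<rightarrow>\<^sub>M path_space" by (rule path.measurable_path_from[OF path.measurable_hit])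
  \<comment> \<open>Which boundary is hit first is known when \<open>y\<close> is hit.\<close>
  have U: "?U \<inter> space M \<in> sets (stopped_sigma M X ?T)"
    using filtration.stopping_time_less[OF filtration_right_filtration T path.stopping_time_hit[of "y - \<delta>"]]
    by (auto simp: pred_def stopped_sigma_def[symmetric] path.space_stopped_sigma Int_def conj_commute)
  have g: "(\<lambda>(\<omega>, w). indicator (?U \<inter> space M) \<omega> * ?h \<omega> w) \<in> borel_measurable (stopped_sigma M X ?T \<Otimes>\<^sub>M path_space)"
  proof -
    note [measurable] = U path.measurable_stopped_sigma_time[OF T]
    show ?thesis unfolding split_beta' by measurable
  qed
  have at: "X (enn2real (hit X y \<omega>)) \<omega> = ereal y" "\<omega> \<in> alive_at ?T" if "\<omega> \<in> space M" "\<omega> \<in> ?U" for \<omega>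
  proof -
    from that(2) have "hit X y \<omega> < hit X (y - \<delta>) \<omega>" by simp
    then have fin: "hit X y \<omega> < \<infinity>" using less_le_trans[OF _ top_greatest] by simp
    show x: "X (enn2real (hit X y \<omega>)) \<omega> = ereal y" by (rule path.X_hit[OF that(1) fin])
    show "\<omega> \<in> alive_at ?T" using that(1) fin x by (simp add: alive_at_def)
  qed
  have pay: "drawdown_payoff f \<delta> (y, s) (path_from X 0 \<omega>) =
      ennreal (f (y, s + enn2real (hit X (y - \<delta>) \<omega>))) * indicator ?L \<omega> + ?h \<omega> (?v \<omega>) * indicator ?U \<omega>" for \<omega>
    unfolding drawdown_payoff_def Let_def
    by (auto simp: path_functionals_path_from_0 path_from_path_from indicator_def)
  have "(\<integral>\<^sup>+\<omega>. ?h \<omega> (?v \<omega>) * indicator ?U \<omega> \<partial>P ?x) =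
      (\<integral>\<^sup>+\<omega>. indicator (alive_at ?T) \<omega> * (indicator (?U \<inter> space M) \<omega> * ?h \<omega> (?v \<omega>)) \<partial>P ?x)"
    using at(2) by (intro nn_integral_cong) (auto simp: space_P indicator_def)
  also have "\<dots> = (\<integral>\<^sup>+\<omega>. indicator (alive_at ?T) \<omega> *
      (\<integral>\<^sup>+w. indicator (?U \<inter> space M) \<omega> * ?h \<omega> w \<partial>law (real_of_ereal (X (enn2real (hit X y \<omega>)) \<omega>))) \<partial>P ?x)"
    by (rule strong_Markov_integral[OF T g])
  also have "\<dots> = (\<integral>\<^sup>+\<omega>. F_dd P X f \<delta> y (s + enn2real (hit X y \<omega>)) * indicator ?U \<omega> \<partial>P ?x)"
  proof (rule nn_integral_cong)
    fix \<omega> assume "\<omega> \<in> space (P ?x)"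
    then have "\<omega> \<in> space M" by (simp add: space_P)
    with at[OF this] show "indicator (alive_at ?T) \<omega> *
        (\<integral>\<^sup>+w. indicator (?U \<inter> space M) \<omega> * ?h \<omega> w \<partial>law (real_of_ereal (X (enn2real (hit X y \<omega>)) \<omega>))) =
        F_dd P X f \<delta> y (s + enn2real (hit X y \<omega>)) * indicator ?U \<omega>"
      by (cases "\<omega> \<in> ?U") (auto simp: F_dd_eq_law[OF f])
  qed
  finally have upper: "(\<integral>\<^sup>+\<omega>. ?h \<omega> (?v \<omega>) * indicator ?U \<omega> \<partial>P ?x) =
      (\<integral>\<^sup>+\<omega>. F_dd P X f \<delta> y (s + enn2real (hit X y \<omega>)) * indicator ?U \<omega> \<partial>P ?x)" .
  have "(\<integral>\<^sup>+w. drawdown_payoff f \<delta> (y, s) w \<partial>law ?x) = (\<integral>\<^sup>+\<omega>. drawdown_payoff f \<delta> (y, s) (path_from X 0 \<omega>) \<partial>P ?x)"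
    by (intro nn_integral_law measurable_drawdown_payoff[OF f]) auto
  also have "\<dots> = (\<integral>\<^sup>+\<omega>. ennreal (f (y, s + enn2real (hit X (y - \<delta>) \<omega>))) * indicator ?L \<omega> \<partial>P ?x) +
      (\<integral>\<^sup>+\<omega>. ?h \<omega> (?v \<omega>) * indicator ?U \<omega> \<partial>P ?x)"
    unfolding pay
  proof (rule nn_integral_add)
    show "(\<lambda>\<omega>. ennreal (f (y, s + enn2real (hit X (y - \<delta>) \<omega>))) * indicator ?L \<omega>) \<in> borel_measurable (P ?x)"
      unfolding measurable_P indicator_def by measurable
    note [measurable] = measurable_compose[OF v W.measurable_drawdown_max, of \<delta>]
      measurable_compose[OF v W.measurable_drawdown_time, of \<delta>]
    show "(\<lambda>\<omega>. ?h \<omega> (?v \<omega>) * indicator ?U \<omega>) \<in> borel_measurable (P ?x)"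
      unfolding measurable_P indicator_def by measurable
  qed
  finally show ?thesis unfolding Q_dd_def upper by simp
qed

lemma Q_dd_max_eq:
  assumes f: "f \<in> borel_measurable borel"
  shows "Q_dd P X (\<lambda>p. f (fst p)) \<rho> \<delta> y s = Q_dd_max P X f \<rho> \<delta> y"
proof -
  note [measurable] = path.measurable_hit
  have *: "(\<integral>\<^sup>+\<omega>. c * indicator {\<omega>. hit X a \<omega> < hit X b \<omega>} \<omega> \<partial>P x) =
      c * emeasure (P x) {\<omega>\<in>space (P x). hit X a \<omega> < hit X b \<omega>}" for a b x and c :: ennreal
  proof -
    have "{\<omega>\<in>space M. hit X a \<omega> < hit X b \<omega>} \<in> sets M" by measurable
    then have "c * emeasure (P x) {\<omega>\<in>space (P x). hit X a \<omega> < hit X b \<omega>} =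
        (\<integral>\<^sup>+\<omega>. c * indicator {\<omega>\<in>space (P x). hit X a \<omega> < hit X b \<omega>} \<omega> \<partial>P x)"
      by (intro nn_integral_cmult_indicator[symmetric]) (simp add: sets_P space_P)
    then show ?thesis by (auto intro!: nn_integral_cong simp: indicator_def)
  qed
  show ?thesis unfolding Q_dd_def Q_dd_max_def F_dd_def fst_conv * ..
qed

text \<open>The level \<open>z\<close> is random but known at the drawdown time, so the strong Markov property reduces the
claim to fixed levels.\<close>
lemma AE_crosses_down_after_drawdown:
  assumes cross: "\<And>z. AE w in law z. crosses_down w z" and \<rho>: "0 \<le> \<rho>"
    and fin: "AE \<omega> in P x. drawdown_time X \<rho> \<omega> < \<infinity>"
  shows "AE \<omega> in P x. let w = path_from X (enn2real (drawdown_time X \<rho> \<omega>)) \<omega>; z = drawdown_max X \<rho> \<omega> - \<delta> in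
    hit coord z w < \<infinity> \<longrightarrow> crosses_down (path_from coord (enn2real (hit coord z w)) w) z"
proof -
  let ?T = "drawdown_time X \<rho>" and ?z = "\<lambda>\<omega>. drawdown_max X \<rho> \<omega> - \<delta>"
  let ?p = "\<lambda>z w. hit coord z w < \<infinity> \<longrightarrow> crosses_down (path_from coord (enn2real (hit coord z w)) w) z"
  have T: "stopping_time (right_filtration M X) ?T" by (rule path.stopping_time_drawdown_time)
  have z [measurable]: "?z \<in> borel_measurable (stopped_sigma M X ?T)"
    using path.measurable_stopped_sigma_drawdown_max[OF \<rho>] by measurable
  have "AE \<omega> in P x. \<omega> \<in> alive_at ?T \<longrightarrow> ?p (?z \<omega>) (path_from X (enn2real (?T \<omega>)) \<omega>)"
  proof (rule strong_Markov_AE[OF T])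
    let ?N = "stopped_sigma M X ?T \<Otimes>\<^sub>M path_space"
    have h [measurable]: "(\<lambda>q. hit coord (?z (fst q)) (snd q)) \<in> borel_measurable ?N"
      by (rule W.hit_compose_measurable) measurable
    have [measurable]: "Measurable.pred ?N (\<lambda>q. crosses_down (path_from coord (enn2real (hit coord (?z (fst q)) (snd q))) (snd q)) (?z (fst q)))"
      by (intro pred_crosses_down W.path_from_compose_measurable h measurable_snd) measurable
    show "Measurable.pred ?N (\<lambda>(\<omega>, w). ?p (?z \<omega>) w)"
      unfolding split_beta' by measurable
    show "AE w in law (real_of_ereal (X (enn2real (?T \<omega>)) \<omega>)). ?p (?z \<omega>) w" for \<omega>
      by (rule AE_law_crosses_down_after_hit[OF cross])
  qed
  then show ?thesis using fin AE_in_space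
  proof eventually_elim
    case (elim \<omega>)
    obtain y where "X (enn2real (?T \<omega>)) \<omega> = ereal (y - \<rho>)"
      using path.drawdown_time_state[OF elim(3) \<rho>, of "enn2real (?T \<omega>)"] elim(2) by auto
    then have "\<omega> \<in> alive_at ?T" using elim(2,3) by (simp add: alive_at_def)
    with elim(1) show ?case by (simp add: Let_def)
  qed
qed

text \<open>The defining equation of the conditional expectation on the event \<open>A\<close>. The indicator of \<open>A\<close> becomes part of
the functional to which the strong Markov property is applied.\<close>
lemma nn_set_integral_drawdown:
  assumes cross: "\<And>z. AE w in law z. crosses_down w z"
    and f: "f \<in> borel_measurable borel" and \<rho>: "0 \<le> \<rho>" "\<rho> < \<delta>"
    and fin: "AE \<omega> in P x. drawdown_time X \<rho> \<omega> < \<infinity>" "AE \<omega> in P x. drawdown_time X \<delta> \<omega> < \<infinity>"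
    and A: "A \<in> sets (stopped_sigma M X (drawdown_time X \<rho>))"
  shows "(\<integral>\<^sup>+\<omega>\<in>A. ennreal (f (drawdown_max X \<delta> \<omega>, enn2real (drawdown_time X \<delta> \<omega>))) \<partial>P x) =
    (\<integral>\<^sup>+\<omega>\<in>A. Q_dd P X f \<rho> \<delta> (drawdown_max X \<rho> \<omega>) (enn2real (drawdown_time X \<rho> \<omega>)) \<partial>P x)"
proof -
  let ?T = "drawdown_time X \<rho>" and ?y = "drawdown_max X \<rho>"
  let ?path = "\<lambda>\<omega>. path_from X (enn2real (?T \<omega>)) \<omega>"
  have T: "stopping_time (right_filtration M X) ?T" by (rule path.stopping_time_drawdown_time)
  define g where "g \<omega> w = indicator A \<omega> * drawdown_payoff f \<delta> (?y \<omega>, enn2real (?T \<omega>)) w" for \<omega> w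
  have g: "(\<lambda>(\<omega>, w). g \<omega> w) \<in> borel_measurable (stopped_sigma M X ?T \<Otimes>\<^sub>M path_space)"
  proof -
    note [measurable] = A path.measurable_stopped_sigma_time[OF T] path.measurable_stopped_sigma_drawdown_max[OF \<rho>(1)]
    have "(\<lambda>q. drawdown_payoff f \<delta> (?y (fst q), enn2real (?T (fst q))) (snd q)) \<in> borel_measurable (stopped_sigma M X ?T \<Otimes>\<^sub>M path_space)"
      by (rule measurable_drawdown_payoff[OF f]) measurable
    then show ?thesis unfolding g_def split_beta' by measurable
  qed
  have state: "AE \<omega> in P x. \<omega> \<in> alive_at ?T \<and> X (enn2real (?T \<omega>)) \<omega> = ereal (?y \<omega> - \<rho>)"
    using fin(1) AE_in_space
  proof eventually_elim
    case (elim \<omega>)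
    obtain y where "X (enn2real (?T \<omega>)) \<omega> = ereal (y - \<rho>)" "?y \<omega> = y"
      using path.drawdown_time_state[OF elim(2) \<rho>(1), of "enn2real (?T \<omega>)"] elim(1) by auto
    then show ?case using elim by (simp add: alive_at_def)
  qed
  have "(\<integral>\<^sup>+\<omega>\<in>A. ennreal (f (drawdown_max X \<delta> \<omega>, enn2real (drawdown_time X \<delta> \<omega>))) \<partial>P x) =
      (\<integral>\<^sup>+\<omega>. indicator (alive_at ?T) \<omega> * g \<omega> (?path \<omega>) \<partial>P x)"
  proof (rule nn_integral_cong_AE)
    show "AE \<omega> in P x. ennreal (f (drawdown_max X \<delta> \<omega>, enn2real (drawdown_time X \<delta> \<omega>))) * indicator A \<omega> =
        indicator (alive_at ?T) \<omega> * g \<omega> (?path \<omega>)"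
      using state fin AE_in_space AE_crosses_down_after_drawdown[OF cross \<rho>(1) fin(1), of \<delta>]
    proof eventually_elim
      case (elim \<omega>)
      from path.drawdown_payoff_at_drawdown[OF elim(4) \<rho> elim(2,3) refl refl elim(5)[unfolded Let_def], of f]
      show ?case using elim(1) by (simp add: g_def mult.commute)
    qed
  qed
  also have "\<dots> = (\<integral>\<^sup>+\<omega>. indicator (alive_at ?T) \<omega> *
      (\<integral>\<^sup>+w. g \<omega> w \<partial>law (real_of_ereal (X (enn2real (?T \<omega>)) \<omega>))) \<partial>P x)"
    by (rule strong_Markov_integral[OF T g])
  also have "\<dots> = (\<integral>\<^sup>+\<omega>\<in>A. Q_dd P X f \<rho> \<delta> (?y \<omega>) (enn2real (?T \<omega>)) \<partial>P x)"
  proof (rule nn_integral_cong_AE)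
    show "AE \<omega> in P x. indicator (alive_at ?T) \<omega> * (\<integral>\<^sup>+w. g \<omega> w \<partial>law (real_of_ereal (X (enn2real (?T \<omega>)) \<omega>))) =
        Q_dd P X f \<rho> \<delta> (?y \<omega>) (enn2real (?T \<omega>)) * indicator A \<omega>"
      using state by eventually_elim (auto simp: g_def Q_dd_eq_law[OF f] indicator_def)
  qed
  finally show ?thesis .
qed

lemma measurable_Q_dd:
  assumes f: "f \<in> borel_measurable borel"
  shows "(\<lambda>p. Q_dd P X f \<rho> \<delta> (fst p) (snd p)) \<in> borel_measurable (borel \<Otimes>\<^sub>M borel)"
proof -
  have "(\<lambda>p :: real \<times> real. law (fst p - \<rho>)) \<in> borel \<Otimes>\<^sub>M borel \<rightarrow>\<^sub>M subprob_algebra path_space"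
    by (rule measurable_compose[OF _ measurable_law]) measurable
  moreover have "(\<lambda>(p, w). drawdown_payoff f \<delta> p w) \<in> borel_measurable ((borel \<Otimes>\<^sub>M borel) \<Otimes>\<^sub>M path_space)"
    unfolding split_beta' by (rule measurable_drawdown_payoff[OF f measurable_fst measurable_snd])
  ultimately show ?thesis
    using nn_integral_measurable_subprob_algebra2[of "drawdown_payoff f \<delta>"] by (simp add: Q_dd_eq_law[OF f])
qed

end

section \<open>Conditional expectations and the Markov property\<close>

context regular_diffusion
begin

lemma subalgebra_stopped_sigma:
  assumes "stopping_time (right_filtration M X) T"
  shows "subalgebra (P x) (stopped_sigma M X T)"
  using path.sets_stopped_sigma_subset[OF assms]
  by (simp add: subalgebra_def path.space_stopped_sigma space_P sets_P)

lemma measurable_payoff_M: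
  assumes "f \<in> borel_measurable borel"
  shows "(\<lambda>\<omega>. ennreal (f (drawdown_max X \<delta> \<omega>, enn2real (drawdown_time X \<delta> \<omega>)))) \<in> borel_measurable M"
proof -
  have [measurable]: "f \<in> borel_measurable (borel \<Otimes>\<^sub>M borel)" using assms by (simp add: borel_prod)
  note [measurable] = path.measurable_drawdown_max path.measurable_drawdown_time
  show ?thesis by measurable
qed

lemma nn_cond_exp_drawdown:
  assumes cross: "\<And>z. AE w in law z. crosses_down w z"
    and f: "f \<in> borel_measurable borel" and \<rho>: "0 \<le> \<rho>" "\<rho> < \<delta>"
    and fin: "AE \<omega> in P x. drawdown_time X \<rho> \<omega> < \<infinity>" "AE \<omega> in P x. drawdown_time X \<delta> \<omega> < \<infinity>"
  shows "AE \<omega> in P x. nn_cond_exp (P x) (stopped_sigma M X (drawdown_time X \<rho>))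
      (\<lambda>\<omega>. ennreal (f (drawdown_max X \<delta> \<omega>, enn2real (drawdown_time X \<delta> \<omega>)))) \<omega> =
    Q_dd P X f \<rho> \<delta> (drawdown_max X \<rho> \<omega>) (enn2real (drawdown_time X \<rho> \<omega>))"
proof -
  let ?F = "stopped_sigma M X (drawdown_time X \<rho>)"
  interpret prob_space "P x" by (rule prob_space_P)
  have T: "stopping_time (right_filtration M X) (drawdown_time X \<rho>)" by (rule path.stopping_time_drawdown_time)
  interpret finite_measure_subalgebra "P x" ?F
    by unfold_locales (rule subalgebra_stopped_sigma[OF T])
  have "AE \<omega> in P x. Q_dd P X f \<rho> \<delta> (drawdown_max X \<rho> \<omega>) (enn2real (drawdown_time X \<rho> \<omega>)) =
    nn_cond_exp (P x) ?F (\<lambda>\<omega>. ennreal (f (drawdown_max X \<delta> \<omega>, enn2real (drawdown_time X \<delta> \<omega>)))) \<omega>"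
  proof (rule nn_cond_exp_charact)
    show "(\<integral>\<^sup>+\<omega>\<in>A. ennreal (f (drawdown_max X \<delta> \<omega>, enn2real (drawdown_time X \<delta> \<omega>))) \<partial>P x) =
      (\<integral>\<^sup>+\<omega>\<in>A. Q_dd P X f \<rho> \<delta> (drawdown_max X \<rho> \<omega>) (enn2real (drawdown_time X \<rho> \<omega>)) \<partial>P x)" if "A \<in> sets ?F" for A
      by (rule nn_set_integral_drawdown[OF cross f \<rho> fin that])
    show "(\<lambda>\<omega>. ennreal (f (drawdown_max X \<delta> \<omega>, enn2real (drawdown_time X \<delta> \<omega>)))) \<in> borel_measurable (P x)"
      unfolding measurable_P by (rule measurable_payoff_M[OF f])
    have [measurable]: "drawdown_max X \<rho> \<in> borel_measurable ?F" "drawdown_time X \<rho> \<in> borel_measurable ?F"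
      using path.measurable_stopped_sigma_drawdown_max[OF \<rho>(1)] path.measurable_stopped_sigma_time[OF T] .
    have "(\<lambda>\<omega>. (drawdown_max X \<rho> \<omega>, enn2real (drawdown_time X \<rho> \<omega>))) \<in> ?F \<rightarrow>\<^sub>M borel \<Otimes>\<^sub>M borel" by measurable
    from measurable_compose[OF this measurable_Q_dd[OF f]]
    show "(\<lambda>\<omega>. Q_dd P X f \<rho> \<delta> (drawdown_max X \<rho> \<omega>) (enn2real (drawdown_time X \<rho> \<omega>))) \<in> borel_measurable ?F" by simp
  qed
  then show ?thesis by eventually_elim simp
qed

text \<open>The point is that \<open>h\<close> does not depend on \<open>G\<close>: for \<open>s < t\<close> it is the kernel evaluated at the maximum at
time \<open>\<theta>\<^sub>s\<close>, which is measurable for \<open>G\<close> and satisfies the defining equation on all of \<open>\<F>\<close> at time \<open>\<theta>\<^sub>s\<close>.\<close>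
lemma real_cond_exp_drawdown_max:
  assumes cross: "\<And>z. AE w in law z. crosses_down w z"
    and fin: "\<And>\<delta>. 0 \<le> \<delta> \<Longrightarrow> AE \<omega> in P x. drawdown_time X \<delta> \<omega> < \<infinity>"
    and st: "0 \<le> s" "s \<le> t" and B: "B \<in> sets borel"
  obtains h where "\<And>G. space G = space M \<Longrightarrow> sets G \<subseteq> sets (stopped_sigma M X (drawdown_time X s)) \<Longrightarrow>
    drawdown_max X s \<in> borel_measurable G \<Longrightarrow>
    AE \<omega> in P x. real_cond_exp (P x) G (\<lambda>\<omega>. indicator B (drawdown_max X t \<omega>)) \<omega> = h \<omega>"
proof -
  interpret prob_space "P x" by (rule prob_space_P)
  let ?T = "drawdown_time X s" and ?f = "indicator B :: real \<Rightarrow> real"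
  have T: "stopping_time (right_filtration M X) ?T" by (rule path.stopping_time_drawdown_time)
  note [measurable] = path.measurable_drawdown_max B
  have Y [measurable]: "drawdown_max X u \<in> borel_measurable (P x)" for u
    unfolding measurable_P by measurable
  \<comment> \<open>The kernel describes strictly later times; at \<open>s = t\<close> the maximum itself is already known.\<close>
  define h where "h \<omega> = (if s = t then ?f (drawdown_max X s \<omega>)
    else enn2real (Q_dd P X (\<lambda>p. ?f (fst p)) s t (drawdown_max X s \<omega>) 0))" for \<omega>
  show thesis
  proof (rule that[of h])
    fix G assume G: "space G = space M" "sets G \<subseteq> sets (stopped_sigma M X ?T)"
      and YG [measurable]: "drawdown_max X s \<in> borel_measurable G"
    have sub: "subalgebra (P x) G"
      using G path.sets_stopped_sigma_subset[OF T] by (auto simp: subalgebra_def space_P sets_P)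
    interpret finite_measure_subalgebra "P x" G by unfold_locales (rule sub)
    show "AE \<omega> in P x. real_cond_exp (P x) G (\<lambda>\<omega>. ?f (drawdown_max X t \<omega>)) \<omega> = h \<omega>"
    proof (cases "s = t")
      case True
      have "integrable (P x) (\<lambda>\<omega>. ?f (drawdown_max X s \<omega>))"
        by (rule integrable_const_bound[of _ 1]) auto
      moreover have "(\<lambda>\<omega>. ?f (drawdown_max X s \<omega>)) \<in> borel_measurable G" by measurable
      ultimately show ?thesis
        using real_cond_exp_F_meas[of "\<lambda>\<omega>. ?f (drawdown_max X s \<omega>)"] by (simp add: h_def True)
    next
      case False
      then have s_t: "s < t" using st by simp
      define q where "q y = Q_dd P X (\<lambda>p. ?f (fst p)) s t y 0" for y
      have fm: "(\<lambda>p :: real \<times> real. ?f (fst p)) \<in> borel_measurable borel"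
        unfolding borel_prod[symmetric] by measurable
      have "(\<lambda>y :: real. (y, 0 :: real)) \<in> borel \<rightarrow>\<^sub>M borel \<Otimes>\<^sub>M borel" by measurable
      from measurable_compose[OF this measurable_Q_dd[OF fm]]
      have q [measurable]: "q \<in> borel_measurable borel" by (simp add: q_def[abs_def])
      have q1: "q y \<le> 1" for y
      proof -
        interpret L: prob_space "law (y - s)"
          unfolding law_def using path.measurable_path_from_0
          by (intro prob_space.prob_space_distr prob_space_P) (simp add: measurable_P)
        have "q y \<le> (\<integral>\<^sup>+w. 1 \<partial>law (y - s))"
          unfolding q_def Q_dd_eq_law[OF fm]
          by (intro nn_integral_mono) (auto simp: drawdown_payoff_def Let_def indicator_def)
        also have "\<dots> = 1" using L.emeasure_space_1 by simp
        finally show ?thesis .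
      qed
      have Q: "Q_dd P X (\<lambda>p. ?f (fst p)) s t y u = q y" for y u
        unfolding q_def Q_dd_max_eq[OF borel_measurable_indicator[OF B]] ..
      have h: "h = (\<lambda>\<omega>. enn2real (q (drawdown_max X s \<omega>)))"
        using False by (simp add: h_def q_def fun_eq_iff)
      have h1: "ennreal (h \<omega>) = q (drawdown_max X s \<omega>)" for \<omega>
        unfolding h using le_less_trans[OF q1[of "drawdown_max X s \<omega>"]] by (simp add: ennreal_enn2real)
      have h0: "0 \<le> h \<omega>" for \<omega> by (simp add: h)
      have hG: "h \<in> borel_measurable G" unfolding h by measurable
      then have hP [measurable]: "h \<in> borel_measurable (P x)" by (rule measurable_from_subalg[OF sub])
      show ?thesis
      proof (rule real_cond_exp_charact[OF _ _ _ hG])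
        show "integrable (P x) (\<lambda>\<omega>. ?f (drawdown_max X t \<omega>))"
          by (rule integrable_const_bound[of _ 1]) auto
        have "h \<omega> \<le> 1" for \<omega>
          using q1[of "drawdown_max X s \<omega>"] h1[of \<omega>] by (metis ennreal_le_1)
        then show "integrable (P x) h"
          using h0 by (intro integrable_const_bound[of _ 1]) auto
        fix A assume A: "A \<in> sets G"
        then have AF: "A \<in> sets (stopped_sigma M X ?T)" using G by auto
        have [measurable]: "A \<in> sets (P x)" using A sub by (auto simp: subalgebra_def)
        have "(\<integral>\<^sup>+\<omega>\<in>A. ennreal (?f (drawdown_max X t \<omega>)) \<partial>P x) = (\<integral>\<^sup>+\<omega>\<in>A. q (drawdown_max X s \<omega>) \<partial>P x)"
          using nn_set_integral_drawdown[OF cross fm st(1) s_t fin fin AF] st by (simp add: Q)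
        then have *: "(\<integral>\<^sup>+\<omega>. ennreal (indicator A \<omega> * ?f (drawdown_max X t \<omega>)) \<partial>P x) =
            (\<integral>\<^sup>+\<omega>. ennreal (indicator A \<omega> * h \<omega>) \<partial>P x)"
          by (simp add: h1[symmetric] ennreal_mult h0 mult.commute ennreal_indicator)
        show "(\<integral>\<omega>\<in>A. ?f (drawdown_max X t \<omega>) \<partial>P x) = (\<integral>\<omega>\<in>A. h \<omega> \<partial>P x)"
          unfolding set_lebesgue_integral_def real_scaleR_def
          using * h0 by (subst (1 2) integral_eq_nn_integral) auto
      qed
    qed
  qed
qed

lemma Markov_process_drawdown_max:
  assumes cross: "\<And>z. AE w in law z. crosses_down w z"
    and fin: "\<And>\<delta>. 0 \<le> \<delta> \<Longrightarrow> AE \<omega> in P x. drawdown_time X \<delta> \<omega> < \<infinity>"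
  shows "Markov_process (P x) (\<lambda>\<delta>. drawdown_max X \<delta>)"
  unfolding Markov_process_def
proof (intro conjI allI impI)
  let ?Y = "\<lambda>\<delta>. drawdown_max X \<delta>"
  show "?Y t \<in> borel_measurable (P x)" for t
    unfolding measurable_P by (rule path.measurable_drawdown_max)
  fix s t :: real and B :: "real set" assume A: "0 \<le> s \<and> s \<le> t \<and> B \<in> sets borel"
  let ?F = "stopped_sigma M X (drawdown_time X s)"
  have YF: "?Y u -` C \<inter> space M \<in> sets ?F" if "0 \<le> u" "u \<le> s" "C \<in> sets borel" for u C
  proof -
    have "?Y u -` C \<inter> space M \<in> sets (stopped_sigma M X (drawdown_time X u))"
      using measurable_sets[OF path.measurable_stopped_sigma_drawdown_max that(3), of u] that(1)
      by (simp add: path.space_stopped_sigma)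
    also have "\<dots> \<subseteq> sets ?F"
      unfolding stopped_sigma_def
      using path.drawdown_time_mono that(2)
      by (intro filtration.mono_pre_sigma[OF filtration_right_filtration] path.stopping_time_drawdown_time)
    finally show ?thesis .
  qed
  obtain h where h: "\<And>G. space G = space M \<Longrightarrow> sets G \<subseteq> sets ?F \<Longrightarrow> ?Y s \<in> borel_measurable G \<Longrightarrow>
    AE \<omega> in P x. real_cond_exp (P x) G (\<lambda>\<omega>. indicator B (?Y t \<omega>)) \<omega> = h \<omega>"
    using real_cond_exp_drawdown_max[OF cross fin, of s t B] A by blast
  have "AE \<omega> in P x. real_cond_exp (P x) (natural_filtration (P x) ?Y (ennreal s)) (\<lambda>\<omega>. indicator B (?Y t \<omega>)) \<omega> = h \<omega>"
  proof (rule h)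
    have "sigma_sets (space ?F) (\<Union>u\<in>{u. 0 \<le> u \<and> ennreal u \<le> ennreal s}. {?Y u -` C \<inter> space M |C. C \<in> sets borel}) \<subseteq> sets ?F"
      using A YF by (intro sets.sigma_sets_subset) (auto simp: ennreal_le_iff)
    then show "sets (natural_filtration (P x) ?Y (ennreal s)) \<subseteq> sets ?F"
      unfolding sets_natural_filtration by (simp add: path.space_stopped_sigma space_P)
    show "?Y s \<in> borel_measurable (natural_filtration (P x) ?Y (ennreal s))"
      using A by (intro measurable_natural_filtration) auto
  qed (simp add: space_natural_filtration space_P)
  moreover have "AE \<omega> in P x. real_cond_exp (P x) (vimage_algebra (space (P x)) (?Y s) borel) (\<lambda>\<omega>. indicator B (?Y t \<omega>)) \<omega> = h \<omega>"
  proof (rule h)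
    show "sets (vimage_algebra (space (P x)) (?Y s) borel) \<subseteq> sets ?F"
      using A YF by (auto simp: sets_vimage_algebra2 space_P)
    show "?Y s \<in> borel_measurable (vimage_algebra (space (P x)) (?Y s) borel)"
      by (rule measurable_vimage_algebra1) auto
  qed (simp add: space_P)
  ultimately show "AE \<omega> in P x.
      real_cond_exp (P x) (natural_filtration (P x) ?Y (ennreal s)) (\<lambda>\<omega>. indicator B (?Y t \<omega>)) \<omega> =
      real_cond_exp (P x) (vimage_algebra (space (P x)) (?Y s) borel) (\<lambda>\<omega>. indicator B (?Y t \<omega>)) \<omega>"
    by eventually_elim simp
qed

end

theorem proposition5p1:
  fixes M :: "'w measure" and P :: "real \<Rightarrow> 'w measure" and X :: "real \<Rightarrow> 'w \<Rightarrow> ereal"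
    and S :: "real \<Rightarrow> real" and m :: "real measure"
  assumes "regular_diffusion M P X"
    and "scale_function P X S" and "S C1_differentiable_on UNIV"
    and "speed_measure P X S m"
    and "\<exists>d. continuous_on UNIV d \<and> (\<forall>x. 0 \<le> d x) \<and> m = density lborel (\<lambda>x. ennreal (d x))"
    and "recurrent P X \<and> filterlim S at_top at_top \<and> filterlim S at_bot at_bot \<or>
         transient P X \<and> (\<exists>L. (S \<longlongrightarrow> L) at_top) \<and> filterlim S at_bot at_bot"
    and "\<forall>\<delta>\<ge>0. AE \<omega> in P 0. drawdown_time X \<delta> \<omega> < \<infinity>"
  shows
    "(\<forall>(f :: real \<times> real \<Rightarrow> real) \<rho> \<delta>.
        f \<in> borel_measurable borel \<and> (\<forall>y\<ge>0. \<forall>t\<ge>0. 0 \<le> f (y, t)) \<and> 0 \<le> \<rho> \<and> \<rho> < \<delta> \<longrightarrow>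
        (AE \<omega> in P 0.
           nn_cond_exp (P 0) (stopped_sigma M X (drawdown_time X \<rho>))
             (\<lambda>\<omega>. ennreal (f (drawdown_max X \<delta> \<omega>, enn2real (drawdown_time X \<delta> \<omega>)))) \<omega> =
           Q_dd P X f \<rho> \<delta> (drawdown_max X \<rho> \<omega>) (enn2real (drawdown_time X \<rho> \<omega>)))) \<and>
     (\<forall>(f :: real \<Rightarrow> real) \<rho> \<delta>.
        f \<in> borel_measurable borel \<and> (\<forall>y\<ge>0. 0 \<le> f y) \<and> 0 \<le> \<rho> \<and> \<rho> < \<delta> \<longrightarrow>
        (AE \<omega> in P 0.
           nn_cond_exp (P 0) (stopped_sigma M X (drawdown_time X \<rho>))
             (\<lambda>\<omega>. ennreal (f (drawdown_max X \<delta> \<omega>))) \<omega> =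
           Q_dd_max P X f \<rho> \<delta> (drawdown_max X \<rho> \<omega>))) \<and>
     Markov_process (P 0) (\<lambda>\<delta>. drawdown_max X \<delta>)"
proof -
  interpret regular_diffusion M P X by fact
  obtain d where d: "continuous_on UNIV d" "m = density lborel (\<lambda>x. ennreal (d x))" using assms(5) by blast
  have cross: "AE w in law z. crosses_down w z" for z
    by (rule AE_law_crosses_down[OF assms(2,4) d])
  have fin: "AE \<omega> in P 0. drawdown_time X \<delta> \<omega> < \<infinity>" if "0 \<le> \<delta>" for \<delta> using assms(7) that by blast
  show ?thesis
  proof (intro conjI allI impI)
    fix f :: "real \<times> real \<Rightarrow> real" and \<rho> \<delta> :: real
    assume "f \<in> borel_measurable borel \<and> (\<forall>y\<ge>0. \<forall>t\<ge>0. 0 \<le> f (y, t)) \<and> 0 \<le> \<rho> \<and> \<rho> < \<delta>"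
    then show "AE \<omega> in P 0. nn_cond_exp (P 0) (stopped_sigma M X (drawdown_time X \<rho>))
        (\<lambda>\<omega>. ennreal (f (drawdown_max X \<delta> \<omega>, enn2real (drawdown_time X \<delta> \<omega>)))) \<omega> =
      Q_dd P X f \<rho> \<delta> (drawdown_max X \<rho> \<omega>) (enn2real (drawdown_time X \<rho> \<omega>))"
      by (intro nn_cond_exp_drawdown[OF cross] fin) auto
  next
    fix f :: "real \<Rightarrow> real" and \<rho> \<delta> :: real
    assume a: "f \<in> borel_measurable borel \<and> (\<forall>y\<ge>0. 0 \<le> f y) \<and> 0 \<le> \<rho> \<and> \<rho> < \<delta>"
    then have [measurable]: "f \<in> borel_measurable borel" by simp
    have fm: "(\<lambda>p :: real \<times> real. f (fst p)) \<in> borel_measurable borel"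
      unfolding borel_prod[symmetric] by measurable
    have "AE \<omega> in P 0. nn_cond_exp (P 0) (stopped_sigma M X (drawdown_time X \<rho>))
        (\<lambda>\<omega>. ennreal (f (fst (drawdown_max X \<delta> \<omega>, enn2real (drawdown_time X \<delta> \<omega>))))) \<omega> =
      Q_dd P X (\<lambda>p. f (fst p)) \<rho> \<delta> (drawdown_max X \<rho> \<omega>) (enn2real (drawdown_time X \<rho> \<omega>))"
      using a by (intro nn_cond_exp_drawdown[OF cross fm] fin) auto
    then show "AE \<omega> in P 0. nn_cond_exp (P 0) (stopped_sigma M X (drawdown_time X \<rho>))
        (\<lambda>\<omega>. ennreal (f (drawdown_max X \<delta> \<omega>))) \<omega> = Q_dd_max P X f \<rho> \<delta> (drawdown_max X \<rho> \<omega>)"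
      by (simp add: Q_dd_max_eq)
  next
    show "Markov_process (P 0) (\<lambda>\<delta>. drawdown_max X \<delta>)"
      by (rule Markov_process_drawdown_max[OF cross fin])
  qed
qed

end
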